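(* $\Gamma_L\cap\Gamma_M$ has index $8$ in each of $\Gamma_L$ and $\Gamma_M$.
   Context: Let $\lambda,\bar\lambda=(-1\pm\sqrt{-7})/2$, so $\lambda+\bar\lambda=-1$, $\lambda\bar\lambda=2$; let $\mathcal{O}=\mathbb{Z}+\lambda\mathbb{Z}$ be the ring of integers of $\mathbb{Q}(\sqrt{-7})=\mathbb{Q}(\lambda)$, and $\theta=\lambda-\bar\lambda=\sqrt{-7}$. On $\mathbb{Q}(\lambda)^3$ use the Hermitian form $\langle x|y\rangle=\frac12\sum x_i\bar y_i$. Define $$L=\{(x_1,x_2,x_3)\in\mathcal{O}^3 : x_i\equiv x_j \bmod \bar\lambda \text{ for all } i,j,\ \text{and } x_1+x_2+x_3\equiv 0\bmod\lambda\},$$ $$M=\{x\in L:\langle x|s\rangle\equiv 0 \bmod \theta\},\qquad s=(\lambda,-\lambda^2,\lambda^3).$$ For $N\in\{L,M\}$, let $N[\frac12]=N\otimes_{\mathcal{O}}\mathcal{O}[\frac12]\subseteq\mathbb{Q}(\lambda)^3$, and let $\Gamma_{N}$ be the group of all $\mathcal{O}[\frac12]$-linear automorphisms of $N[\frac12]$ preserving $\langle\cdot|\cdot\rangle$, regarded as a subgroup of $\mathrm{GL}_3(\mathbb{Q}(\lambda))$; the intersection is taken there. *)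

theory Defs
  imports "HOL-Analysis.Analysis" "HOL-Algebra.Coset"
begin

text \<open>The number field is realised inside \<^typ>\<open>complex\<close>, so that its conjugation is \<^const>\<open>cnj\<close>.\<close>

definition lam :: complex where
  "lam = (-1 + \<i> * complex_of_real (sqrt 7)) / 2"

definition theta :: complex where
  "theta = lam - cnj lam"

definition Qlam :: "complex set" where
  "Qlam = {of_rat a + of_rat b * lam | a b. True}"

definition Olam :: "complex set" where
  "Olam = {of_int a + of_int b * lam | a b. True}"

definition Olam_half :: "complex set" where
  "Olam_half = {a / 2 ^ k | a (k::nat). a \<in> Olam}"

definition O_cong :: "complex \<Rightarrow> complex \<Rightarrow> complex \<Rightarrow> bool" where
  "O_cong m a b \<longleftrightarrow> (\<exists>c\<in>Olam. a - b = m * c)"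

definition herm :: "complex ^ 3 \<Rightarrow> complex ^ 3 \<Rightarrow> complex" where
  "herm x y = (1 / 2) * (\<Sum>i\<in>UNIV. x $ i * cnj (y $ i))"

definition lattice_L :: "(complex ^ 3) set" where
  "lattice_L = {x. (\<forall>i. x $ i \<in> Olam) \<and> (\<forall>i j. O_cong (cnj lam) (x $ i) (x $ j)) \<and>
                   O_cong lam (x $ 1 + x $ 2 + x $ 3) 0}"

definition vec_s :: "complex ^ 3" where
  "vec_s = vector [lam, - (lam ^ 2), lam ^ 3]"

definition lattice_M :: "(complex ^ 3) set" where
  "lattice_M = {x \<in> lattice_L. O_cong theta (herm x vec_s) 0}"

text \<open>The tensor product of \<open>N\<close> with \<^const>\<open>Olam_half\<close> over \<^const>\<open>Olam\<close>, identified with its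
  (isomorphic, by flatness) image in the ambient space: the \<^const>\<open>Olam_half\<close>-span of \<open>N\<close>.\<close>

definition localize :: "(complex ^ 3) set \<Rightarrow> (complex ^ 3) set" where
  "localize N = {\<Sum>i<n. r i *s v i | (n::nat) r v. \<forall>i<n. r i \<in> Olam_half \<and> v i \<in> N}"

definition isometric_automorphism ::
    "(complex ^ 3) set \<Rightarrow> (complex ^ 3 \<Rightarrow> complex ^ 3) \<Rightarrow> bool" where
  "isometric_automorphism P \<phi> \<longleftrightarrow>
     bij_betw \<phi> P P \<and>
     (\<forall>x\<in>P. \<forall>y\<in>P. \<phi> (x + y) = \<phi> x + \<phi> y) \<and>
     (\<forall>r\<in>Olam_half. \<forall>x\<in>P. \<phi> (r *s x) = r *s \<phi> x) \<and>
     (\<forall>x\<in>P. \<forall>y\<in>P. herm (\<phi> x) (\<phi> y) = herm x y)"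

definition Mat3 :: "(complex ^ 3 ^ 3) monoid" where
  "Mat3 = \<lparr>carrier = {A. \<forall>i j. A $ i $ j \<in> Qlam}, mult = (**), one = mat 1\<rparr>"

text \<open>Inverses are taken in \<^const>\<open>Mat3\<close>, so they too have entries in \<^const>\<open>Qlam\<close>.\<close>

definition GL3 :: "(complex ^ 3 ^ 3) monoid" where
  "GL3 = units_of Mat3"

text \<open>The lattices above span \<open>Qlam^3\<close>, so an automorphism of the localized lattice is the
  restriction of exactly one element of \<^const>\<open>GL3\<close>; the group is the set of these elements.\<close>

definition Gamma_group :: "(complex ^ 3) set \<Rightarrow> (complex ^ 3 ^ 3) set" where
  "Gamma_group N = {A \<in> carrier GL3. isometric_automorphism (localize N) ((*v) A)}"

lemma lam_square: "lam * lam = - lam - 2"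
proof -
  have "complex_of_real (sqrt 7) * complex_of_real (sqrt 7) = 7"
    by (simp flip: of_real_mult)
  then show ?thesis
    unfolding lam_def by (simp add: field_simps)
qed

lemma cnj_lam: "lam + cnj lam = -1" "lam * cnj lam = 2"
proof -
  show *: "lam + cnj lam = -1"
    unfolding lam_def by (simp add: field_simps)
  have "cnj lam = -1 - lam"
    unfolding *[symmetric] by simp
  then have "lam * cnj lam = - lam - lam * lam"
    by (simp only:) (simp add: algebra_simps)
  then show "lam * cnj lam = 2"
    unfolding lam_square by simp
qed

lemma theta_square: "theta ^ 2 = -7"
proof -
  have eq: "theta = 2 * lam + 1"
    unfolding theta_def lam_def by (simp add: field_simps)
  have "theta ^ 2 = 4 * (lam * lam) + 4 * lam + 1"
    unfolding eq by (simp add: power2_eq_square algebra_simps)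
  then show ?thesis
    unfolding lam_square by simp
qed

lemma Qlam_of_rat: "of_rat a \<in> Qlam"
  unfolding Qlam_def by (rule CollectI, rule exI[of _ a], rule exI[of _ 0]) simp

lemma Qlam_add: "x \<in> Qlam \<Longrightarrow> y \<in> Qlam \<Longrightarrow> x + y \<in> Qlam"
proof -
  assume "x \<in> Qlam" "y \<in> Qlam"
  then obtain a b c d where "x = of_rat a + of_rat b * lam" "y = of_rat c + of_rat d * lam"
    unfolding Qlam_def by blast
  then have "x + y = of_rat (a + c) + of_rat (b + d) * lam"
    by (simp add: of_rat_add algebra_simps)
  then show ?thesis unfolding Qlam_def by blast
qed

lemma Qlam_mult: "x \<in> Qlam \<Longrightarrow> y \<in> Qlam \<Longrightarrow> x * y \<in> Qlam"
proof -
  assume "x \<in> Qlam" "y \<in> Qlam"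
  then obtain a b c d where xy: "x = of_rat a + of_rat b * lam" "y = of_rat c + of_rat d * lam"
    unfolding Qlam_def by blast
  have "x * y = of_rat a * of_rat c + (of_rat a * of_rat d + of_rat b * of_rat c) * lam
      + of_rat b * of_rat d * (lam * lam)"
    unfolding xy by (simp add: algebra_simps)
  also have "\<dots> = of_rat (a * c - 2 * b * d) + of_rat (a * d + b * c - b * d) * lam"
    unfolding lam_square by (simp add: of_rat_add of_rat_diff of_rat_mult algebra_simps)
  finally show ?thesis unfolding Qlam_def by blast
qed

lemma Qlam_sum: "(\<And>i. i \<in> I \<Longrightarrow> f i \<in> Qlam) \<Longrightarrow> sum f I \<in> Qlam"
  using Qlam_of_rat[of 0]
  by (induction I rule: infinite_finite_induct) (auto intro: Qlam_add)

lemma monoid_Mat3: "monoid Mat3"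
proof (rule monoidI)
  fix A B assume "A \<in> carrier Mat3" "B \<in> carrier Mat3"
  then show "A \<otimes>\<^bsub>Mat3\<^esub> B \<in> carrier Mat3"
    by (auto simp: Mat3_def matrix_matrix_mult_def intro!: Qlam_sum Qlam_mult)
next
  show "\<one>\<^bsub>Mat3\<^esub> \<in> carrier Mat3"
    using Qlam_of_rat[of 0] Qlam_of_rat[of 1] by (auto simp: Mat3_def mat_def)
qed (simp_all add: Mat3_def matrix_mul_assoc)

lemma group_GL3: "group GL3"
  unfolding GL3_def using monoid_Mat3 by (rule monoid.units_group)

lemma subgroup_Gamma_group: "subgroup (Gamma_group N) GL3"
proof -
  interpret group GL3 by (rule group_GL3)
  have mult: "A \<otimes>\<^bsub>GL3\<^esub> B = A ** B" for A B
    by (simp add: GL3_def Mat3_def units_of_mult)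
  have one: "\<one>\<^bsub>GL3\<^esub> = mat 1"
    by (simp add: GL3_def Mat3_def units_of_one)
  have Gamma_group_iff: "A \<in> Gamma_group N \<longleftrightarrow> A \<in> carrier GL3 \<and> bij_betw ((*v) A) (localize N) (localize N)
      \<and> (\<forall>x\<in>localize N. \<forall>y\<in>localize N. herm (A *v x) (A *v y) = herm x y)" for A
    unfolding Gamma_group_def isometric_automorphism_def
    by (auto simp: matrix_vector_right_distrib matrix_vector_mult_def vec_eq_iff
        sum_distrib_left algebra_simps sum.distrib)
  show ?thesis
  proof
    show "Gamma_group N \<subseteq> carrier GL3"
      by (auto simp: Gamma_group_def)
    show "\<one>\<^bsub>GL3\<^esub> \<in> Gamma_group N"
      unfolding Gamma_group_iff using one_closed by (auto simp: one bij_betw_def inj_on_def)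
  next
    fix A B assume A: "A \<in> Gamma_group N" and B: "B \<in> Gamma_group N"
    have eq: "(*v) (A ** B) = (*v) A \<circ> (*v) B"
      by (auto simp: matrix_vector_mul_assoc)
    have "bij_betw ((*v) (A ** B)) (localize N) (localize N)"
      unfolding eq using A B Gamma_group_iff by (blast intro: bij_betw_trans)
    moreover have "B *v x \<in> localize N" if "x \<in> localize N" for x
      using B that unfolding Gamma_group_iff by (blast dest: bij_betwE)
    ultimately show "A \<otimes>\<^bsub>GL3\<^esub> B \<in> Gamma_group N"
      using A B m_closed[of A B] unfolding Gamma_group_iff mult
      by (simp flip: matrix_vector_mul_assoc)
  next
    fix A assume A: "A \<in> Gamma_group N"
    define B where "B = inv\<^bsub>GL3\<^esub> A"
    have AG: "A \<in> carrier GL3" using A by (simp add: Gamma_group_iff)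
    have AB: "A ** B = mat 1" and BA: "B ** A = mat 1"
      using r_inv[OF AG] l_inv[OF AG] by (simp_all add: mult one B_def)
    have ABx: "A *v (B *v x) = x" and BAx: "B *v (A *v x) = x" for x
      by (simp_all add: matrix_vector_mul_assoc AB BA)
    have im: "(*v) A ` localize N = localize N"
      using A unfolding Gamma_group_iff by (blast dest: bij_betw_imp_surj_on)
    have Bin: "B *v x \<in> localize N" if "x \<in> localize N" for x
    proof -
      from that im obtain y where "y \<in> localize N" "x = A *v y" by blast
      then show ?thesis by (simp add: BAx)
    qed
    have "bij_betw ((*v) B) (localize N) (localize N)"
      by (rule bij_betw_byWitness[where f' = "(*v) A"]) (use im Bin in \<open>auto simp: ABx BAx\<close>)
    moreover have "herm (B *v x) (B *v y) = herm x y" if "x \<in> localize N" "y \<in> localize N" for x y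
      using A Bin[OF that(1)] Bin[OF that(2)] unfolding Gamma_group_iff by (metis ABx)
    ultimately show "inv\<^bsub>GL3\<^esub> A \<in> Gamma_group N"
      unfolding Gamma_group_iff B_def[symmetric] using AG by (simp add: B_def)
  qed
qed

end

theory Submission
  imports Defs
begin

text \<open>
  Write \<open>R = O[1/2]\<close>. Then \<open>L[1/2] = R\<^sup>3\<close>, the residue field \<open>R / \<theta> R\<close> has 7 elements, and \<open>M[1/2]\<close> consists
  of the vectors of \<open>R\<^sup>3\<close> orthogonal modulo \<open>\<theta>\<close> to the isotropic line of \<open>s\<close>. The index of
  \<open>\<Gamma>\<^sub>L \<inter> \<Gamma>\<^sub>M\<close> in \<open>\<Gamma>\<^sub>L\<close> is the size of the \<open>\<Gamma>\<^sub>L\<close>-orbit of \<open>M[1/2]\<close>: its members correspond to isotropic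
  lines modulo \<open>\<theta>\<close>, a conic with 8 points, on which the signed permutation matrices are already
  transitive. Likewise the index in \<open>\<Gamma>\<^sub>M\<close> is the size of the \<open>\<Gamma>\<^sub>M\<close>-orbit of \<open>L[1/2]\<close>: its members are
  lattices strictly between \<open>M[1/2]\<close> and its dual, that is, lines in the plane \<open>M\<^sup>* / M\<close> over the
  field with 7 elements. All 8 lines occur: an explicit isometry moves the line of \<open>L\<close>, and
  diagonal isometries fixing that line permute the 7 others cyclically.
\<close>

section \<open>The residue field\<close>

lemma cnj_lam_eq: "cnj lam = - 1 - lam"
  using cnj_lam(1) by (simp add: algebra_simps)

text \<open>The variant of \<open>lam_square\<close> for right-nested products, the shape that
  \<open>algebra_simps\<close> produces; the two rules together reduce polynomials in
  \<open>lam\<close> to degree at most one.\<close>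

lemma lam_square_left: "lam * (lam * x) = - (lam * x) - 2 * x"
  using lam_square by (simp flip: mult.assoc) (simp add: algebra_simps)

lemmas lam_reduce = algebra_simps lam_square lam_square_left

lemma theta_eq: "theta = 2 * lam + 1"
  unfolding theta_def cnj_lam_eq by simp

lemma theta_mult: "theta * theta = - 7"
  using theta_square by (simp add: power2_eq_square)

lemma theta_nonzero: "theta \<noteq> 0"
  using theta_mult by auto

lemma cnj_theta: "cnj theta = - theta"
  by (simp add: theta_def)

lemma lam_coordinates_unique:
  assumes "of_int a + of_int b * lam = of_int c + of_int d * lam"
  shows "a = c \<and> b = d"
proof -
  have "Im (of_int a + of_int b * lam) = Im (of_int c + of_int d * lam)"
    using assms by simp
  then have "b = d"
    by (simp add: lam_def)
  then show ?thesis
    using assms by simp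
qed

section \<open>The rings O and O[1/2]\<close>

lemma Olam_of_int [simp]: "of_int n \<in> Olam"
  unfolding Olam_def by (rule CollectI, rule exI[of _ n], rule exI[of _ 0]) simp

lemma Olam_numerals [simp]: "0 \<in> Olam" "1 \<in> Olam" "numeral k \<in> Olam"
  using Olam_of_int[of 0] Olam_of_int[of 1] Olam_of_int[of "numeral k"] by simp_all

lemma Olam_lam [simp]: "lam \<in> Olam"
  unfolding Olam_def by (rule CollectI, rule exI[of _ 0], rule exI[of _ 1]) simp

lemma Olam_add [intro]:
  assumes "x \<in> Olam" "y \<in> Olam"
  shows "x + y \<in> Olam"
proof -
  obtain a b c d where "x = of_int a + of_int b * lam" "y = of_int c + of_int d * lam"
    using assms unfolding Olam_def by blast
  then have "x + y = of_int (a + c) + of_int (b + d) * lam"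
    by (simp add: algebra_simps)
  then show ?thesis unfolding Olam_def by blast
qed

lemma Olam_mult [intro]:
  assumes "x \<in> Olam" "y \<in> Olam"
  shows "x * y \<in> Olam"
proof -
  obtain a b c d where xy: "x = of_int a + of_int b * lam" "y = of_int c + of_int d * lam"
    using assms unfolding Olam_def by blast
  have "x * y = of_int a * of_int c + (of_int a * of_int d + of_int b * of_int c) * lam
      + of_int b * of_int d * (lam * lam)"
    unfolding xy by (simp add: algebra_simps)
  also have "\<dots> = of_int (a * c - 2 * b * d) + of_int (a * d + b * c - b * d) * lam"
    unfolding lam_square by (simp add: algebra_simps)
  finally show ?thesis unfolding Olam_def by blast
qed

lemma Olam_power [intro]: "x \<in> Olam \<Longrightarrow> x ^ k \<in> Olam"
  by (induction k) auto

lemma Olam_uminus [intro]: "x \<in> Olam \<Longrightarrow> - x \<in> Olam"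
  using Olam_mult[of "of_int (- 1)" x] Olam_of_int[of "- 1"] by simp

lemma Olam_diff [intro]: "x \<in> Olam \<Longrightarrow> y \<in> Olam \<Longrightarrow> x - y \<in> Olam"
  using Olam_add[of x "- y"] by auto

lemma Olam_cnj [intro]:
  assumes "x \<in> Olam"
  shows "cnj x \<in> Olam"
proof -
  obtain a b where "x = of_int a + of_int b * lam"
    using assms unfolding Olam_def by blast
  then have "cnj x = of_int a + of_int b * (- 1 - lam)"
    by (simp add: cnj_lam_eq)
  also have "\<dots> \<in> Olam"
    by (intro Olam_add Olam_mult Olam_diff Olam_uminus) auto
  finally show ?thesis .
qed

lemma Olam_halfE:
  assumes "x \<in> Olam_half"
  obtains k where "2 ^ k * x \<in> Olam"
proof -
  obtain a and k :: nat where "x = a / 2 ^ k" "a \<in> Olam"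
    using assms unfolding Olam_half_def by blast
  then have "2 ^ k * x \<in> Olam"
    by simp
  then show ?thesis
    by (rule that)
qed

lemma Olam_halfI: "2 ^ k * x \<in> Olam \<Longrightarrow> x \<in> Olam_half"
  unfolding Olam_half_def by (rule CollectI, rule exI[of _ "2 ^ k * x"], rule exI[of _ k]) simp

lemma Olam_imp_half: "x \<in> Olam \<Longrightarrow> x \<in> Olam_half"
  by (rule Olam_halfI[of 0]) simp

lemma Olam_half_numerals [simp]:
  "0 \<in> Olam_half" "1 \<in> Olam_half" "numeral k \<in> Olam_half" "of_int n \<in> Olam_half"
  "lam \<in> Olam_half"
  by (auto intro: Olam_imp_half)

lemma Olam_half_half [simp]: "1 / 2 \<in> Olam_half"
  by (rule Olam_halfI[of 1]) simp

lemma Olam_half_add [intro]: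
  assumes "x \<in> Olam_half" "y \<in> Olam_half"
  shows "x + y \<in> Olam_half"
proof -
  obtain k l where kl: "2 ^ k * x \<in> Olam" "2 ^ l * y \<in> Olam"
    using assms by (meson Olam_halfE)
  have "2 ^ l * (2 ^ k * x) + 2 ^ k * (2 ^ l * y) \<in> Olam"
    by (rule Olam_add[OF Olam_mult[OF _ kl(1)] Olam_mult[OF _ kl(2)]]) auto
  also have "2 ^ l * (2 ^ k * x) + 2 ^ k * (2 ^ l * y) = 2 ^ (k + l) * (x + y)"
    by (simp add: power_add algebra_simps)
  finally show ?thesis by (rule Olam_halfI)
qed

lemma Olam_half_mult [intro]:
  assumes "x \<in> Olam_half" "y \<in> Olam_half"
  shows "x * y \<in> Olam_half"
proof -
  obtain k l where "2 ^ k * x \<in> Olam" "2 ^ l * y \<in> Olam"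
    using assms by (meson Olam_halfE)
  then have "(2 ^ k * x) * (2 ^ l * y) \<in> Olam"
    by (rule Olam_mult)
  also have "(2 ^ k * x) * (2 ^ l * y) = 2 ^ (k + l) * (x * y)"
    by (simp add: power_add)
  finally show ?thesis by (rule Olam_halfI)
qed

lemma Olam_half_uminus [intro]: "x \<in> Olam_half \<Longrightarrow> - x \<in> Olam_half"
  using Olam_half_mult[of "of_int (- 1)" x] Olam_half_numerals(4)[of "- 1"] by simp

lemma Olam_half_diff [intro]: "x \<in> Olam_half \<Longrightarrow> y \<in> Olam_half \<Longrightarrow> x - y \<in> Olam_half"
  using Olam_half_add[of x "- y"] by auto

lemma Olam_half_power [intro]: "x \<in> Olam_half \<Longrightarrow> x ^ k \<in> Olam_half"
  by (induction k) auto

lemma Olam_half_cnj [intro]: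
  assumes "x \<in> Olam_half"
  shows "cnj x \<in> Olam_half"
proof -
  obtain k where "2 ^ k * x \<in> Olam"
    using assms by (rule Olam_halfE)
  then have "2 ^ k * cnj x \<in> Olam"
    using Olam_cnj by fastforce
  then show ?thesis by (rule Olam_halfI)
qed

lemma Olam_half_theta [simp]: "theta \<in> Olam_half"
  unfolding theta_eq by (intro Olam_half_add Olam_half_mult) auto

lemma Olam_half_Qlam: "x \<in> Olam_half \<Longrightarrow> x \<in> Qlam"
proof -
  assume "x \<in> Olam_half"
  then obtain a b :: int and k :: nat where "x = (of_int a + of_int b * lam) / 2 ^ k"
    unfolding Olam_half_def Olam_def by blast
  then have "x = of_rat (of_int a / 2 ^ k) + of_rat (of_int b / 2 ^ k) * lam"
    by (simp add: of_rat_divide of_rat_power add_divide_distrib)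
  then show ?thesis unfolding Qlam_def by blast
qed

lemmas Olam_half_intros =
  Olam_half_add Olam_half_mult Olam_half_diff Olam_half_uminus Olam_half_power Olam_half_cnj
  Olam_half_numerals Olam_half_half Olam_half_theta

section \<open>The ideal of O[1/2] generated by \<open>theta\<close>, the kernel of reduction to the
  field with 7 elements\<close>

definition theta_ideal :: "complex set" where
  "theta_ideal = {theta * c | c. c \<in> Olam_half}"

lemma theta_idealI [intro]: "c \<in> Olam_half \<Longrightarrow> theta * c \<in> theta_ideal"
  by (auto simp: theta_ideal_def)

lemma theta_ideal_half: "x \<in> theta_ideal \<Longrightarrow> x \<in> Olam_half"
  by (auto simp: theta_ideal_def)

lemma theta_ideal_add: "x \<in> theta_ideal \<Longrightarrow> y \<in> theta_ideal \<Longrightarrow> x + y \<in> theta_ideal"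
  unfolding theta_ideal_def by (auto simp flip: distrib_left)

lemma theta_ideal_mult: "r \<in> Olam_half \<Longrightarrow> x \<in> theta_ideal \<Longrightarrow> r * x \<in> theta_ideal"
  unfolding theta_ideal_def by (auto simp: mult.left_commute)

lemma theta_ideal_uminus: "x \<in> theta_ideal \<Longrightarrow> - x \<in> theta_ideal"
  using theta_ideal_mult[of "- 1" x] by (auto intro: Olam_half_intros)

lemma theta_ideal_diff: "x \<in> theta_ideal \<Longrightarrow> y \<in> theta_ideal \<Longrightarrow> x - y \<in> theta_ideal"
  using theta_ideal_add[of x "- y"] by (auto intro: theta_ideal_uminus)

lemma theta_ideal_cnj: "x \<in> theta_ideal \<Longrightarrow> cnj x \<in> theta_ideal"
  unfolding theta_ideal_def
  by (auto simp: cnj_theta) (metis Olam_half_cnj Olam_half_uminus mult_minus_right)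

lemma theta_ideal_0 [simp]: "0 \<in> theta_ideal"
  using theta_idealI[of 0] by simp

text \<open>Modulo \<open>theta = 2 * lam + 1\<close> one has \<open>2 * lam = -1 = 6\<close>, so
  \<open>lam\<close> has residue 3.\<close>

lemma theta_ideal_lam: "lam - 3 \<in> theta_ideal"
proof -
  have "theta * (1 + lam) = lam - 3"
    by (simp add: theta_eq lam_reduce)
  then show ?thesis
    by (metis theta_idealI Olam_half_add Olam_half_numerals(2,5))
qed

lemma theta_ideal_seven: "7 \<in> theta_ideal"
proof -
  have "theta * (- theta) = 7"
    using theta_mult by simp
  then show ?thesis
    by (metis theta_idealI Olam_half_uminus Olam_half_theta)
qed

text \<open>Clearing the powers of 2 in \<open>n = theta * c\<close> and comparing coordinates with
  respect to 1 and \<open>lam\<close> shows that 7 divides \<open>n * 2 ^ k\<close>; conversely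
  \<open>7 = - theta * theta\<close>.\<close>

lemma theta_ideal_of_int: "of_int n \<in> theta_ideal \<longleftrightarrow> 7 dvd n"
proof
  assume "of_int n \<in> theta_ideal"
  then obtain c where c: "of_int n = theta * c" "c \<in> Olam_half"
    unfolding theta_ideal_def by auto
  then obtain p q and k :: nat where "c = (of_int p + of_int q * lam) / 2 ^ k"
    unfolding Olam_half_def Olam_def by blast
  then have "of_int (n * 2 ^ k) = theta * (of_int p + of_int q * lam)"
    using c by simp
  also have "\<dots> = of_int p + 2 * of_int p * lam + of_int q * lam + 2 * of_int q * (lam * lam)"
    unfolding theta_eq by (simp add: algebra_simps)
  also have "\<dots> = of_int (p - 4 * q) + of_int (2 * p - q) * lam"
    unfolding lam_square by (simp add: algebra_simps)
  finally have "of_int (n * 2 ^ k) + of_int 0 * lam = of_int (p - 4 * q) + of_int (2 * p - q) * lam"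
    by simp
  then have "n * 2 ^ k = p - 4 * q \<and> 0 = 2 * p - q"
    by (rule lam_coordinates_unique)
  then have "n * 2 ^ k = 7 * (- p)"
    by simp
  then have "7 dvd n * 2 ^ k"
    by (metis dvd_triv_left)
  moreover have "coprime (7 :: int) 2"
    by (simp flip: coprime_iff_gcd_eq_1 add: gcd_red_int)
  ultimately show "7 dvd n"
    by (simp add: coprime_dvd_mult_left_iff)
next
  assume "7 dvd n"
  then obtain m where "n = m * 7"
    by (metis dvd_def mult.commute)
  then show "of_int n \<in> theta_ideal"
    using theta_ideal_mult[OF _ theta_ideal_seven, of "of_int m"] by simp
qed

lemma theta_ideal_cong_mult:
  assumes "x - a \<in> theta_ideal" "y - b \<in> theta_ideal" "x \<in> Olam_half" "b \<in> Olam_half"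
  shows "x * y - a * b \<in> theta_ideal"
proof -
  have "x * (y - b) + b * (x - a) \<in> theta_ideal"
    using assms by (intro theta_ideal_add theta_ideal_mult)
  then show ?thesis
    by (simp add: algebra_simps)
qed

lemma theta_ideal_cong_power:
  assumes "x - a \<in> theta_ideal" "x \<in> Olam_half" "a \<in> Olam_half"
  shows "x ^ k - a ^ k \<in> theta_ideal"
  using assms by (induction k) (auto intro!: theta_ideal_cong_mult)

lemma theta_residue:
  assumes "x \<in> Olam_half"
  obtains n :: int where "n \<in> {0..6}" "x - of_int n \<in> theta_ideal"
proof -
  obtain a b and k :: nat where x: "x = (of_int a + of_int b * lam) / 2 ^ k"
    using assms unfolding Olam_half_def Olam_def by blast
  \<comment> \<open>In the residue field 4 is the inverse of 2 and 3 is the image of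
    \<open>lam\<close>.\<close>
  define m where "m = 4 ^ k * (a + b * 3)"
  have "1 / 2 - 4 = (- 1 / 2) * (7 :: complex)"
    by simp
  also have "\<dots> \<in> theta_ideal"
    by (intro theta_ideal_mult theta_ideal_seven) (use Olam_half_uminus Olam_half_half in fastforce)
  finally have "(1 / 2) ^ k - 4 ^ k \<in> theta_ideal"
    by (intro theta_ideal_cong_power) auto
  moreover have "(of_int a + of_int b * lam) - of_int (a + b * 3) = of_int b * (lam - 3)"
    by (simp add: algebra_simps)
  then have "(of_int a + of_int b * lam) - of_int (a + b * 3) \<in> theta_ideal"
    using theta_ideal_mult[OF _ theta_ideal_lam, of "of_int b"] by simp
  ultimately have "(1 / 2) ^ k * (of_int a + of_int b * lam) - 4 ^ k * of_int (a + b * 3)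
      \<in> theta_ideal"
    by (intro theta_ideal_cong_mult) (auto intro: Olam_half_intros simp del: of_int_add of_int_mult)
  then have "x - of_int m \<in> theta_ideal"
    by (simp add: x m_def power_divide)
  moreover have "of_int (m - m mod 7) \<in> theta_ideal"
    unfolding theta_ideal_of_int by simp
  ultimately have "(x - of_int m) + of_int (m - m mod 7) \<in> theta_ideal"
    by (rule theta_ideal_add)
  then have "x - of_int (m mod 7) \<in> theta_ideal"
    by simp
  moreover have "m mod 7 \<in> {0..6}"
    using pos_mod_bound[of 7 m] by simp
  ultimately show ?thesis
    using that by blast
qed

section \<open>Localized lattices and their isometry groups\<close>

definition cube :: "(complex ^ 3) set" where
  "cube = {x. \<forall>i. x $ i \<in> Olam_half}"

text \<open>Since \<open>\<theta>\<close> divides \<open>\<lambda> - 3\<close>, the vector \<open>s\<close> is proportional to \<open>(1, 4, 2)\<close> modulo \<open>\<theta>\<close>, so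
  \<open>M[1/2]\<close> is the case \<open>b = 4\<close>, \<open>c = 2\<close>.\<close>

definition mod_theta_plane :: "int \<Rightarrow> int \<Rightarrow> (complex ^ 3) set" where
  "mod_theta_plane b c =
     {x \<in> cube. x $ 1 + of_int b * x $ 2 + of_int c * x $ 3 \<in> theta_ideal}"

lemma mod_theta_plane_cube: "x \<in> mod_theta_plane b c \<Longrightarrow> x \<in> cube"
  by (simp add: mod_theta_plane_def)

lemma cubeD: "x \<in> cube \<Longrightarrow> x $ i \<in> Olam_half"
  by (simp add: cube_def)

text \<open>Closure of \<open>P\<close> under combinations gives one inclusion; for the other,
  \<open>x\<close> is \<open>1 / 2 ^ k\<close> times the element \<open>2 ^ k *s x\<close> of
  \<open>N\<close>, a combination with one term.\<close>

lemma localize_eqI: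
  assumes sub: "N \<subseteq> P" and zero: "0 \<in> P"
    and add: "\<And>x y. x \<in> P \<Longrightarrow> y \<in> P \<Longrightarrow> x + y \<in> P"
    and mult: "\<And>r x. r \<in> Olam_half \<Longrightarrow> x \<in> P \<Longrightarrow> r *s x \<in> P"
    and absorb: "\<And>x. x \<in> P \<Longrightarrow> \<exists>k::nat. 2 ^ k *s x \<in> N"
  shows "localize N = P"
proof
  show "localize N \<subseteq> P"
  proof
    fix x assume "x \<in> localize N"
    then obtain n :: nat and r v where x: "x = (\<Sum>i<n. r i *s v i)"
      and rv: "\<forall>i<n. r i \<in> Olam_half \<and> v i \<in> N"
      unfolding localize_def by blast
    have "(\<Sum>i\<in>I. r i *s v i) \<in> P" if "\<forall>i\<in>I. r i \<in> Olam_half \<and> v i \<in> N" for I :: "nat set"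
      using that by (induction I rule: infinite_finite_induct) (use sub zero add mult in auto)
    then show "x \<in> P"
      using x rv by simp
  qed
next
  show "P \<subseteq> localize N"
  proof
    fix x assume "x \<in> P"
    then obtain k :: nat where k: "2 ^ k *s x \<in> N"
      using absorb by blast
    have "1 / 2 ^ k \<in> Olam_half"
      by (rule Olam_halfI[of k]) simp
    moreover have "x = (\<Sum>i<(1::nat). (1 / 2 ^ k) *s (2 ^ k *s x))"
      by (simp add: vector_smult_assoc)
    ultimately show "x \<in> localize N"
      unfolding localize_def using k
      by (intro CollectI exI[of _ "1 :: nat"] exI[of _ "\<lambda>_. 1 / 2 ^ k"] exI[of _ "\<lambda>_. 2 ^ k *s x"]) simp
  qed
qed

lemma cube_absorb:
  assumes "x \<in> cube"
  obtains k :: nat where "\<And>i. 2 ^ k * x $ i \<in> Olam"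
proof -
  have "\<forall>i. \<exists>k::nat. 2 ^ k * x $ i \<in> Olam"
    using assms unfolding cube_def by (blast elim: Olam_halfE)
  then obtain K :: "3 \<Rightarrow> nat" where K: "\<And>i. 2 ^ K i * x $ i \<in> Olam"
    by metis
  have "2 ^ (K 1 + K 2 + K 3) * x $ i \<in> Olam" for i
  proof -
    have "K i \<le> K 1 + K 2 + K 3"
      using exhaust_3[of i] by auto
    then have "2 ^ (K 1 + K 2 + K 3) * x $ i = 2 ^ (K 1 + K 2 + K 3 - K i) * (2 ^ K i * x $ i)"
      by (simp flip: power_add mult.assoc)
    also have "\<dots> \<in> Olam"
      by (rule Olam_mult[OF _ K]) auto
    finally show ?thesis .
  qed
  then show ?thesis
    using that by blast
qed

lemma lattice_L_cube: "lattice_L \<subseteq> cube"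
  by (auto simp: lattice_L_def cube_def intro: Olam_imp_half)

text \<open>Since \<open>2 = lam * cnj lam\<close>, doubling forces the congruences modulo
  \<open>cnj lam\<close> and modulo \<open>lam\<close> at once. Hence the conditions defining L
  disappear when 2 is inverted.\<close>

lemma double_lattice_L:
  assumes "\<And>i. y $ i \<in> Olam"
  shows "2 *s y \<in> lattice_L"
proof -
  have "O_cong (cnj lam) (2 * a) (2 * b)" if "a \<in> Olam" "b \<in> Olam" for a b
    unfolding O_cong_def
  proof
    show "2 * a - 2 * b = cnj lam * (lam * (a - b))"
      using cnj_lam(2) by (simp flip: mult.assoc add: mult.commute right_diff_distrib)
    show "lam * (a - b) \<in> Olam"
      using that by auto
  qed
  moreover have "O_cong lam (2 * a) 0" if "a \<in> Olam" for a
    unfolding O_cong_def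
  proof
    show "2 * a - 0 = lam * (cnj lam * a)"
      using cnj_lam(2) by (simp flip: mult.assoc)
    show "cnj lam * a \<in> Olam"
      using that by (intro Olam_mult Olam_cnj Olam_lam)
  qed
  then have "O_cong lam (2 * (y $ 1 + y $ 2 + y $ 3)) 0"
    using assms by blast
  ultimately show ?thesis
    using assms by (auto simp: lattice_L_def distrib_left)
qed

lemma localize_lattice_L: "localize lattice_L = cube"
proof (rule localize_eqI)
  fix x assume "x \<in> cube"
  then obtain k :: nat where "\<And>i. 2 ^ k * x $ i \<in> Olam"
    by (rule cube_absorb) blast
  then have "2 *s (2 ^ k *s x) \<in> lattice_L"
    by (intro double_lattice_L) simp
  then show "\<exists>k::nat. 2 ^ k *s x \<in> lattice_L"
    by (intro exI[of _ "Suc k"]) (simp add: vector_smult_assoc)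
qed (use lattice_L_cube in \<open>auto simp: cube_def\<close>)

text \<open>The conjugate of \<open>vec_s\<close> is \<open>cnj lam\<close> times
  \<open>(1, 1 + lam, lam - 1)\<close>, and this vector is \<open>(1, 4, 2)\<close> plus
  \<open>lam - 3\<close> times \<open>(0, 1, 1)\<close>.\<close>

lemma herm_vec_s:
  "herm x vec_s = cnj lam / 2 * ((x $ 1 + 4 * x $ 2 + 2 * x $ 3) + (lam - 3) * (x $ 2 + x $ 3))"
  unfolding herm_def vec_s_def
  by (simp add: sum_3 power2_eq_square power3_eq_cube cnj_lam_eq field_simps lam_square lam_square_left)

text \<open>The factor \<open>cnj lam / 2\<close> is the inverse of \<open>lam\<close>, hence a unit
  of O[1/2], and the term with \<open>lam - 3\<close> vanishes modulo \<open>theta\<close>.\<close>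

lemma herm_vec_s_theta:
  assumes "x \<in> cube"
  shows "herm x vec_s \<in> theta_ideal \<longleftrightarrow> x $ 1 + 4 * x $ 2 + 2 * x $ 3 \<in> theta_ideal"
    (is "_ \<longleftrightarrow> ?e \<in> _")
proof -
  have r: "cnj lam / 2 \<in> Olam_half"
    using Olam_half_mult[OF Olam_half_half Olam_half_cnj[of lam]] by simp
  have d: "(lam - 3) * (x $ 2 + x $ 3) \<in> theta_ideal"
    using theta_ideal_mult[OF _ theta_ideal_lam, of "x $ 2 + x $ 3"] assms
    by (simp add: mult.commute Olam_half_add cubeD)
  have e: "?e = lam * herm x vec_s - (lam - 3) * (x $ 2 + x $ 3)"
    unfolding herm_vec_s using cnj_lam(2) by (simp flip: mult.assoc) (simp add: field_simps)
  show ?thesis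
  proof
    assume "herm x vec_s \<in> theta_ideal"
    then show "?e \<in> theta_ideal"
      unfolding e by (intro theta_ideal_diff theta_ideal_mult d) auto
  next
    assume "?e \<in> theta_ideal"
    then show "herm x vec_s \<in> theta_ideal"
      unfolding herm_vec_s by (rule theta_ideal_mult[OF r theta_ideal_add[OF _ d]])
  qed
qed

lemma herm_smult: "herm (c *s x) y = c * herm x y"
  by (simp add: herm_def sum_3 algebra_simps)

lemma herm_smult_right: "herm x (c *s y) = cnj c * herm x y"
  by (simp add: herm_def sum_3 algebra_simps)

lemma mod_theta_plane_vec_s: "mod_theta_plane 4 2 = {x \<in> cube. herm x vec_s \<in> theta_ideal}"
  using herm_vec_s_theta by (auto simp: mod_theta_plane_def)

lemma localize_lattice_M: "localize lattice_M = mod_theta_plane 4 2"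
proof (rule localize_eqI)
  show "lattice_M \<subseteq> mod_theta_plane 4 2"
    using lattice_L_cube
    by (auto simp: mod_theta_plane_vec_s lattice_M_def O_cong_def theta_ideal_def intro: Olam_imp_half)
next
  fix x assume "x \<in> mod_theta_plane 4 2"
  then have x: "x \<in> cube" "herm x vec_s \<in> theta_ideal"
    by (auto simp: mod_theta_plane_vec_s)
  then obtain k :: nat where k: "\<And>i. 2 ^ k * x $ i \<in> Olam"
    by (metis cube_absorb)
  \<comment> \<open>Besides the coordinates of \<open>x\<close>, the quotient of the form value by
    \<open>theta\<close> must become integral, because \<open>lattice_M\<close> asks for a multiple
    of \<open>theta\<close> over O. One more factor 2 then leads into L.\<close>
  obtain c where c: "herm x vec_s = theta * c" "c \<in> Olam_half"
    using x by (auto simp: theta_ideal_def)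
  then obtain j :: nat where j: "2 ^ j * c \<in> Olam"
    by (metis Olam_halfE)
  have "2 ^ j * (2 ^ k * x $ i) \<in> Olam" for i
    by (rule Olam_mult[OF _ k]) auto
  then have "2 *s (2 ^ j *s (2 ^ k *s x)) \<in> lattice_L"
    by (intro double_lattice_L) (simp add: mult.assoc)
  moreover have "2 ^ Suc (j + k) *s x = 2 *s (2 ^ j *s (2 ^ k *s x))"
    by (simp add: power_add vector_smult_assoc mult.assoc)
  moreover have "herm (2 ^ Suc (j + k) *s x) vec_s - 0 = theta * (2 ^ Suc k * (2 ^ j * c))"
    by (simp add: herm_smult c power_add)
  moreover have "2 ^ Suc k * (2 ^ j * c) \<in> Olam"
    by (rule Olam_mult[OF _ j]) (rule Olam_power, simp)
  ultimately have "2 ^ Suc (j + k) *s x \<in> lattice_M"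
    unfolding lattice_M_def O_cong_def by auto
  then show "\<exists>k::nat. 2 ^ k *s x \<in> lattice_M"
    by blast
next
  fix x y assume "x \<in> mod_theta_plane 4 2" "y \<in> mod_theta_plane 4 2"
  then show "x + y \<in> mod_theta_plane 4 2"
    using theta_ideal_add[of "x $ 1 + 4 * x $ 2 + 2 * x $ 3" "y $ 1 + 4 * y $ 2 + 2 * y $ 3"]
    by (auto simp: mod_theta_plane_def cube_def algebra_simps)
next
  fix r x assume "r \<in> Olam_half" "x \<in> mod_theta_plane 4 2"
  then show "r *s x \<in> mod_theta_plane 4 2"
    using theta_ideal_mult[of r "x $ 1 + 4 * x $ 2 + 2 * x $ 3"]
    by (auto simp: mod_theta_plane_def cube_def algebra_simps)
qed (simp add: mod_theta_plane_def cube_def)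

text \<open>This puts the multiples by \<open>theta\<close> of the standard basis into M[1/2],
  enough to recover a matrix from its action there.\<close>

lemma theta_cube_mod_theta_plane:
  assumes "x \<in> cube"
  shows "theta *s x \<in> mod_theta_plane b c"
proof -
  have "theta * (x $ 1 + of_int b * x $ 2 + of_int c * x $ 3) \<in> theta_ideal"
    using assms by (intro theta_idealI) (auto intro!: Olam_half_intros cubeD)
  then show ?thesis
    using assms by (auto simp: mod_theta_plane_def cube_def algebra_simps)
qed

section \<open>Unitary matrices and stabilizers of localized lattices\<close>

definition adjoint_matrix :: "complex ^ 3 ^ 3 \<Rightarrow> complex ^ 3 ^ 3" where
  "adjoint_matrix A = (\<chi> i j. cnj (A $ j $ i))"

definition unitary :: "complex ^ 3 ^ 3 \<Rightarrow> bool" where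
  "unitary A \<longleftrightarrow> adjoint_matrix A ** A = mat 1"

lemma herm_adjoint: "herm (A *v x) y = herm x (adjoint_matrix A *v y)"
  by (simp add: herm_def sum_3 adjoint_matrix_def matrix_vector_mult_def algebra_simps)

lemma unitary_herm: "unitary A \<Longrightarrow> herm (A *v x) (A *v y) = herm x y"
  by (simp add: herm_adjoint matrix_vector_mul_assoc unitary_def)

lemma matrix_axis: "((A :: complex ^ 3 ^ 3) *v axis j 1) $ i = A $ i $ j"
  using exhaust_3[of j] by (auto simp: matrix_vector_mult_def axis_def sum_3)

lemma unitaryI:
  assumes "\<And>i j. herm (A *v axis i 1) (A *v axis j 1) = herm (axis i 1) (axis j 1)"
  shows "unitary A"
proof -
  have "(adjoint_matrix A ** A) $ j $ i = (mat 1 :: complex ^ 3 ^ 3) $ j $ i" for i j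
  proof -
    have "(adjoint_matrix A ** A) $ j $ i = 2 * herm (A *v axis i 1) (A *v axis j 1)"
      by (simp add: matrix_axis herm_def adjoint_matrix_def matrix_matrix_mult_def mult.commute)
    also have "\<dots> = 2 * herm (axis i 1) (axis j 1)"
      using assms by simp
    also have "\<dots> = (mat 1 :: complex ^ 3 ^ 3) $ j $ i"
      using exhaust_3[of i] exhaust_3[of j] by (auto simp: herm_def axis_def mat_def sum_3)
    finally show ?thesis .
  qed
  then show ?thesis
    by (simp add: unitary_def vec_eq_iff)
qed

lemma GL3_iff: "A \<in> carrier GL3 \<longleftrightarrow> (\<forall>i j. A $ i $ j \<in> Qlam) \<and>
    (\<exists>B. (\<forall>i j. B $ i $ j \<in> Qlam) \<and> A ** B = mat 1 \<and> B ** A = mat 1)"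
  by (auto simp: GL3_def units_of_def Units_def Mat3_def)

lemma GL3_inverse:
  assumes "A \<in> carrier GL3"
  obtains B where "\<And>x. A *v (B *v x) = x" "\<And>x. B *v (A *v x) = x"
proof -
  obtain B where "A ** B = mat 1" "B ** A = mat 1"
    using assms unfolding GL3_iff by blast
  then show ?thesis
    by (intro that[of B]) (simp_all add: matrix_vector_mul_assoc)
qed

lemma GL3_mult: "A \<otimes>\<^bsub>GL3\<^esub> B = A ** B"
  by (simp add: GL3_def Mat3_def units_of_mult)

lemma GL3_one: "\<one>\<^bsub>GL3\<^esub> = mat 1"
  by (simp add: GL3_def Mat3_def units_of_one)

lemma Qlam_cnj: "x \<in> Qlam \<Longrightarrow> cnj x \<in> Qlam"
proof -
  assume "x \<in> Qlam"
  then obtain a b where x: "x = of_rat a + of_rat b * lam"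
    unfolding Qlam_def by blast
  have "cnj (of_rat q) = of_rat q" for q
    by (cases q) (simp add: of_rat_rat)
  then have "cnj x = of_rat (a - b) + of_rat (- b) * lam"
    by (simp add: x cnj_lam_eq of_rat_diff of_rat_minus algebra_simps)
  then show ?thesis
    unfolding Qlam_def by blast
qed

lemma unitary_GL3:
  assumes "unitary A" "\<And>i j. A $ i $ j \<in> Qlam"
  shows "A \<in> carrier GL3"
proof -
  have "A ** adjoint_matrix A = mat 1"
    using assms(1) unfolding unitary_def by (simp add: matrix_left_right_inverse)
  then show ?thesis
    using assms unfolding GL3_iff unitary_def
    by (intro conjI exI[of _ "adjoint_matrix A"]) (auto simp: adjoint_matrix_def Qlam_cnj)
qed

text \<open>The localized lattice contains \<open>theta *s axis i 1\<close>, so preserving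
  \<open>herm\<close> on it fixes the Gram matrix of the columns of \<open>A\<close> after division
  by the nonzero \<open>theta * cnj theta\<close>. What remains is that \<open>A\<close> and its
  inverse preserve the lattice.\<close>

lemma Gamma_group_iff:
  assumes theta: "\<And>x. x \<in> cube \<Longrightarrow> theta *s x \<in> localize N"
  shows "A \<in> Gamma_group N \<longleftrightarrow>
    A \<in> carrier GL3 \<and> unitary A \<and> (\<forall>x. A *v x \<in> localize N \<longleftrightarrow> x \<in> localize N)"
    (is "?lhs \<longleftrightarrow> ?rhs")
proof
  assume A: ?lhs
  then have GL: "A \<in> carrier GL3" and bij: "bij_betw ((*v) A) (localize N) (localize N)"
    and pres: "\<And>x y. x \<in> localize N \<Longrightarrow> y \<in> localize N \<Longrightarrow> herm (A *v x) (A *v y) = herm x y"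
    unfolding Gamma_group_def isometric_automorphism_def by auto
  obtain B where B: "\<And>x. B *v (A *v x) = x"
    using GL3_inverse[OF GL] by metis
  have "axis i 1 \<in> cube" for i
    by (auto simp: cube_def axis_def)
  then have "herm (A *v (theta *s axis i 1)) (A *v (theta *s axis j 1))
      = herm (theta *s axis i 1) (theta *s axis j 1)" for i j
    by (intro pres theta)
  then have "unitary A"
    using theta_nonzero
    by (intro unitaryI) (simp add: vector_scalar_commute herm_smult herm_smult_right)
  moreover have "x \<in> localize N" if "A *v x \<in> localize N" for x
  proof -
    from that obtain y where "y \<in> localize N" "A *v x = A *v y"
      using bij unfolding bij_betw_def by blast
    then show ?thesis
      by (metis B)
  qed
  moreover have "A *v x \<in> localize N" if "x \<in> localize N" for x
    using bij that by (auto dest: bij_betwE)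
  ultimately show ?rhs
    using GL by blast
next
  assume A: ?rhs
  then obtain B where AB: "\<And>x. A *v (B *v x) = x" and BA: "\<And>x. B *v (A *v x) = x"
    by (metis GL3_inverse)
  have "bij_betw ((*v) A) (localize N) (localize N)"
  proof (rule bij_betw_byWitness[where f' = "(*v) B"])
    show "(*v) B ` localize N \<subseteq> localize N"
      using A AB by (metis image_subsetI)
  qed (use A AB BA in auto)
  then show ?lhs
    using A unitary_herm
    by (simp add: Gamma_group_def isometric_automorphism_def vector_scalar_commute
        matrix_vector_right_distrib)
qed

lemma theta_lattice_L: "x \<in> cube \<Longrightarrow> theta *s x \<in> localize lattice_L"
  unfolding localize_lattice_L by (auto simp: cube_def)

lemma theta_lattice_M: "x \<in> cube \<Longrightarrow> theta *s x \<in> localize lattice_M"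
  unfolding localize_lattice_M by (rule theta_cube_mod_theta_plane)

lemma Gamma_group_L_iff: "A \<in> Gamma_group lattice_L \<longleftrightarrow>
    A \<in> carrier GL3 \<and> unitary A \<and> (\<forall>x. A *v x \<in> cube \<longleftrightarrow> x \<in> cube)"
  using Gamma_group_iff[OF theta_lattice_L] by (simp add: localize_lattice_L)

lemma Gamma_group_M_iff: "A \<in> Gamma_group lattice_M \<longleftrightarrow>
    A \<in> carrier GL3 \<and> unitary A \<and>
    (\<forall>x. A *v x \<in> mod_theta_plane 4 2 \<longleftrightarrow> x \<in> mod_theta_plane 4 2)"
  using Gamma_group_iff[OF theta_lattice_M] by (simp add: localize_lattice_M)

section \<open>The index as the size of an orbit of lattices\<close>

lemma card_image_eqI:
  assumes "\<And>a b. a \<in> S \<Longrightarrow> b \<in> S \<Longrightarrow> f a = f b \<longleftrightarrow> g a = g b"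
  shows "card (f ` S) = card (g ` S)"
proof (rule bij_betw_same_card)
  have "f (inv_into S f (f a)) = f a \<and> inv_into S f (f a) \<in> S" if "a \<in> S" for a
    using that by (simp add: f_inv_into_f inv_into_into)
  then have g: "g (inv_into S f (f a)) = g a" if "a \<in> S" for a
    using that assms by blast
  show "bij_betw (\<lambda>y. g (inv_into S f y)) (f ` S) (g ` S)"
    unfolding bij_betw_def
  proof
    show "inj_on (\<lambda>y. g (inv_into S f y)) (f ` S)"
      by (rule inj_onI) (use g assms in auto)
    show "(\<lambda>y. g (inv_into S f y)) ` f ` S = g ` S"
      using g by (auto simp: image_image)
  qed
qed

text \<open>Orbit and stabilizer: \<open>A\<close> and \<open>B\<close> have the same preimage of
  \<open>localize N2\<close> exactly when \<open>A\<close> times the inverse of \<open>B\<close>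
  stabilizes \<open>localize N2\<close>. Right cosets therefore match preimages, not images.\<close>

lemma card_rcosets_Gamma_group:
  assumes th1: "\<And>x. x \<in> cube \<Longrightarrow> theta *s x \<in> localize N1"
    and th2: "\<And>x. x \<in> cube \<Longrightarrow> theta *s x \<in> localize N2"
  shows "card (rcosets\<^bsub>GL3\<lparr>carrier := Gamma_group N1\<rparr>\<^esub> (Gamma_group N1 \<inter> Gamma_group N2)) =
    card ((\<lambda>A. {x. A *v x \<in> localize N2}) ` Gamma_group N1)"
proof -
  interpret group GL3 by (rule group_GL3)
  define H where "H = Gamma_group N1 \<inter> Gamma_group N2"
  have H: "subgroup H GL3"
    unfolding H_def by (intro subgroups_Inter_pair subgroup_Gamma_group)
  have G1: "subgroup (Gamma_group N1) GL3"
    by (rule subgroup_Gamma_group)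
  have iff1: "A \<in> Gamma_group N1 \<longleftrightarrow>
      A \<in> carrier GL3 \<and> unitary A \<and> (\<forall>x. A *v x \<in> localize N1 \<longleftrightarrow> x \<in> localize N1)" for A
    by (rule Gamma_group_iff) (rule th1)
  have iff2: "A \<in> Gamma_group N2 \<longleftrightarrow>
      A \<in> carrier GL3 \<and> unitary A \<and> (\<forall>x. A *v x \<in> localize N2 \<longleftrightarrow> x \<in> localize N2)" for A
    by (rule Gamma_group_iff) (rule th2)
  have "rcosets\<^bsub>GL3\<lparr>carrier := Gamma_group N1\<rparr>\<^esub> H = (\<lambda>A. H #>\<^bsub>GL3\<^esub> A) ` Gamma_group N1"
    by (simp add: RCOSETS_def r_coset_def UNION_singleton_eq_range)
  moreover have "H #>\<^bsub>GL3\<^esub> a = H #>\<^bsub>GL3\<^esub> b \<longleftrightarrow>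
      {x. a *v x \<in> localize N2} = {x. b *v x \<in> localize N2}"
    if a: "a \<in> Gamma_group N1" and b: "b \<in> Gamma_group N1" for a b
  proof
    have ac: "a \<in> carrier GL3" and bc: "b \<in> carrier GL3"
      using subgroup.mem_carrier[OF G1] a b by simp_all
    assume "H #>\<^bsub>GL3\<^esub> a = H #>\<^bsub>GL3\<^esub> b"
    then have "a \<in> H #>\<^bsub>GL3\<^esub> b"
      using rcos_self[OF ac H] by simp
    then obtain h where "h \<in> Gamma_group N2" "a = h ** b"
      by (auto simp: r_coset_def H_def GL3_mult)
    then show "{x. a *v x \<in> localize N2} = {x. b *v x \<in> localize N2}"
      unfolding iff2 by (simp flip: matrix_vector_mul_assoc)
  next
    have ac: "a \<in> carrier GL3" and bc: "b \<in> carrier GL3"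
      using subgroup.mem_carrier[OF G1] a b by simp_all
    assume eq: "{x. a *v x \<in> localize N2} = {x. b *v x \<in> localize N2}"
    define b' where "b' = inv\<^bsub>GL3\<^esub> b"
    define c where "c = a ** b'"
    have b'c: "b' \<in> carrier GL3"
      using bc by (simp add: b'_def)
    have c1: "c \<in> Gamma_group N1"
      using subgroup.m_closed[OF G1 a subgroup.m_inv_closed[OF G1 b]]
      by (simp add: c_def b'_def GL3_mult)
    have "b ** b' = mat 1" "b' ** b = mat 1"
      using r_inv[OF bc] l_inv[OF bc] by (simp_all add: GL3_mult GL3_one b'_def)
    then have bb: "b *v (b' *v x) = x" and cb: "c ** b = a" for x
      by (simp_all add: matrix_vector_mul_assoc c_def flip: matrix_mul_assoc)
    have "c *v x \<in> localize N2 \<longleftrightarrow> x \<in> localize N2" for x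
    proof -
      have "c *v x = a *v (b' *v x)"
        by (simp add: c_def matrix_vector_mul_assoc)
      moreover have "a *v (b' *v x) \<in> localize N2 \<longleftrightarrow> b *v (b' *v x) \<in> localize N2"
        using eq by blast
      ultimately show ?thesis
        by (simp add: bb)
    qed
    then have "c \<in> Gamma_group N2"
      using c1 unfolding iff1 iff2 by blast
    then have cH: "c \<in> H"
      using c1 by (simp add: H_def)
    then have "c \<in> carrier GL3"
      by (rule subgroup.mem_carrier[OF H])
    have "H #>\<^bsub>GL3\<^esub> a = H #>\<^bsub>GL3\<^esub> (c \<otimes>\<^bsub>GL3\<^esub> b)"
      by (simp add: GL3_mult cb)
    also have "\<dots> = (H #>\<^bsub>GL3\<^esub> c) #>\<^bsub>GL3\<^esub> b"
      using coset_mult_assoc[OF subgroup.subset[OF H] \<open>c \<in> carrier GL3\<close> bc] by simp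
    also have "H #>\<^bsub>GL3\<^esub> c = H"
      using coset_join2[OF \<open>c \<in> carrier GL3\<close> H cH] .
    finally show "H #>\<^bsub>GL3\<^esub> a = H #>\<^bsub>GL3\<^esub> b" .
  qed
  ultimately show ?thesis
    unfolding H_def[symmetric] by (simp only:) (rule card_image_eqI)
qed

section \<open>Isotropic lines\<close>

text \<open>A Bezout relation between \<open>n\<close> and 7 makes \<open>n\<close> invertible
  modulo \<open>theta\<close>.\<close>

lemma theta_ideal_cancel:
  assumes "of_int n * y \<in> theta_ideal" "\<not> 7 dvd n" "y \<in> Olam_half"
  shows "y \<in> theta_ideal"
proof -
  have "prime (7 :: int)"
    by simp
  then have "coprime n 7"
    using assms(2) prime_imp_coprime[of 7 n] by (simp add: coprime_commute)
  then obtain m k where mk: "m * n + k * 7 = 1"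
    using bezout_int[of n 7] by auto
  have "of_int m * (of_int n * y) + (of_int k * y) * 7 \<in> theta_ideal"
    using assms by (intro theta_ideal_add theta_ideal_mult[OF _ assms(1)]
        theta_ideal_mult[OF _ theta_ideal_seven]) auto
  also have "of_int m * (of_int n * y) + (of_int k * y) * 7 = of_int (m * n + k * 7) * y"
    by (simp add: algebra_simps)
  finally show ?thesis
    by (simp add: mk)
qed

lemma theta_ideal_cong: "x - y \<in> theta_ideal \<Longrightarrow> x \<in> theta_ideal \<longleftrightarrow> y \<in> theta_ideal"
  using theta_ideal_add[of "x - y" y] theta_ideal_diff[of x "x - y"] by auto

lemma theta_ideal_of_int_mult: "7 dvd n \<Longrightarrow> x \<in> Olam_half \<Longrightarrow> of_int n * x \<in> theta_ideal"
  using theta_ideal_mult[of x "of_int n"] by (simp add: theta_ideal_of_int mult.commute)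

lemma mod_theta_plane_cong:
  assumes "7 dvd b - b'" "7 dvd c - c'"
  shows "mod_theta_plane b c = mod_theta_plane b' c'"
proof -
  have "x $ 1 + of_int b * x $ 2 + of_int c * x $ 3 \<in> theta_ideal \<longleftrightarrow>
      x $ 1 + of_int b' * x $ 2 + of_int c' * x $ 3 \<in> theta_ideal" if "x \<in> cube" for x
  proof (rule theta_ideal_cong)
    have "of_int (b - b') * x $ 2 + of_int (c - c') * x $ 3 \<in> theta_ideal"
      using assms that by (intro theta_ideal_add theta_ideal_of_int_mult cubeD)
    then show "x $ 1 + of_int b * x $ 2 + of_int c * x $ 3 -
        (x $ 1 + of_int b' * x $ 2 + of_int c' * x $ 3) \<in> theta_ideal"
      by (simp add: algebra_simps)
  qed
  then show ?thesis
    by (auto simp: mod_theta_plane_def)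
qed

lemma mod_theta_plane_inj:
  assumes "mod_theta_plane b c = mod_theta_plane b' c'"
  shows "7 dvd b' - b \<and> 7 dvd c' - c"
proof -
  \<comment> \<open>On these two kernel vectors the linear form with coefficients
    \<open>(1, b', c')\<close> takes the values \<open>b' - b\<close> and
    \<open>c' - c\<close>.\<close>
  have "vector [- of_int b, 1, 0] \<in> mod_theta_plane b c"
    "vector [- of_int c, 0, 1] \<in> mod_theta_plane b c"
    by (auto simp: mod_theta_plane_def cube_def forall_3)
  then have "of_int (b' - b) \<in> theta_ideal \<and> of_int (c' - c) \<in> theta_ideal"
    unfolding assms by (simp add: mod_theta_plane_def)
  then show ?thesis
    unfolding theta_ideal_of_int .
qed

text \<open>The isotropic lines of \<open>x\<^sup>2 + y\<^sup>2 + z\<^sup>2\<close> over the field with 7 elements, normalised to \<open>x = 1\<close>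
  (no coordinate vanishes, as \<open>-1\<close> is not a square).\<close>

definition isotropic_pairs :: "(int \<times> int) set" where
  "isotropic_pairs = {(2, 3), (2, 4), (5, 3), (5, 4), (3, 2), (4, 2), (3, 5), (4, 5)}"

text \<open>A finite check over all 343 triples of residues: a nonzero isotropic triple is
  \<open>a\<close> times \<open>(1, p, q)\<close> modulo 7.\<close>

lemma isotropic_pairs_exhaust:
  fixes a b c :: int
  assumes "a \<in> {0..6}" "b \<in> {0..6}" "c \<in> {0..6}" "7 dvd a * a + b * b + c * c"
    and "\<not> (a = 0 \<and> b = 0 \<and> c = 0)"
  obtains p q where "(p, q) \<in> isotropic_pairs" "\<not> 7 dvd a" "7 dvd b - a * p" "7 dvd c - a * q"
proof -
  have "\<forall>a\<in>set [0..6]. \<forall>b\<in>set [0..6]. \<forall>c\<in>set [0..6].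
      (a * a + b * b + c * c) mod 7 = 0 \<longrightarrow> \<not> (a = 0 \<and> b = 0 \<and> c = 0) \<longrightarrow> a \<noteq> 0 \<and>
      (\<exists>(p, q)\<in>set [(2, 3), (2, 4), (5, 3), (5, 4), (3, 2), (4, 2), (3, 5), (4, 5 :: int)].
        (b - a * p) mod 7 = 0 \<and> (c - a * q) mod (7 :: int) = 0)"
    by code_simp
  from this[unfolded set_upto, rule_format, OF assms(1-3)] assms(4,5)
  have a: "a \<noteq> 0"
    and "\<exists>(p, q)\<in>isotropic_pairs. 7 dvd b - a * p \<and> 7 dvd c - a * q"
    unfolding dvd_eq_mod_eq_0 isotropic_pairs_def by simp_all
  moreover have "\<not> 7 dvd a"
    using a assms(1) by (auto dest: zdvd_imp_le)
  ultimately show ?thesis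
    using that by blast
qed

text \<open>Conjugation fixes integers and preserves the ideal, so it acts trivially on residues.
  Modulo \<open>theta\<close> the form becomes the ordinary dot product, up to the unit
  \<open>1 / 2\<close>.\<close>

lemma herm_theta_residue:
  assumes x: "x \<in> cube" and v: "\<And>i. v $ i - of_int (n i) \<in> theta_ideal"
  shows "herm x v \<in> theta_ideal \<longleftrightarrow>
    of_int (n 1) * x $ 1 + of_int (n 2) * x $ 2 + of_int (n 3) * x $ 3 \<in> theta_ideal"
proof -
  have "cnj (v $ i) - of_int (n i) \<in> theta_ideal" for i
    using theta_ideal_cnj[OF v[of i]] by simp
  then have "x $ 1 * (cnj (v $ 1) - of_int (n 1)) + x $ 2 * (cnj (v $ 2) - of_int (n 2)) +
      x $ 3 * (cnj (v $ 3) - of_int (n 3)) \<in> theta_ideal"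
    using x by (intro theta_ideal_add theta_ideal_mult cubeD)
  then have "2 * herm x v -
      (of_int (n 1) * x $ 1 + of_int (n 2) * x $ 2 + of_int (n 3) * x $ 3) \<in> theta_ideal"
    by (simp add: herm_def sum_3 algebra_simps)
  then have "2 * herm x v \<in> theta_ideal \<longleftrightarrow>
      of_int (n 1) * x $ 1 + of_int (n 2) * x $ 2 + of_int (n 3) * x $ 3 \<in> theta_ideal"
    by (rule theta_ideal_cong)
  moreover have "2 * herm x v \<in> theta_ideal \<longleftrightarrow> herm x v \<in> theta_ideal"
    using theta_ideal_mult[OF Olam_half_half, of "2 * herm x v"] theta_ideal_mult[of 2 "herm x v"]
    by auto
  ultimately show ?thesis
    by simp
qed

text \<open>Orthogonality to \<open>v\<close> modulo \<open>theta\<close> depends only on the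
  residues \<open>n\<close> of \<open>v\<close>. These form a nonzero isotropic triple, and its
  first entry can be cancelled to normalise the linear form.\<close>

lemma orthogonal_plane_of_isotropic:
  assumes v: "v \<in> cube" "herm v v \<in> theta_ideal" "\<not> (\<forall>i. v $ i \<in> theta_ideal)"
  obtains p q where "(p, q) \<in> isotropic_pairs"
    "{x \<in> cube. herm x v \<in> theta_ideal} = mod_theta_plane p q"
proof -
  have "\<exists>n\<in>{0..6}. v $ i - of_int n \<in> theta_ideal" for i
    by (meson theta_residue v(1) cubeD)
  then obtain n where n: "\<And>i. n i \<in> {0..6}" "\<And>i. v $ i - of_int (n i) \<in> theta_ideal"
    by metis
  \<comment> \<open>The linear form attached to \<open>v\<close> is evaluated at \<open>v\<close>
    itself; replacing \<open>v\<close> by its residues next gives the sum of squares.\<close>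
  have "of_int (n 1) * v $ 1 + of_int (n 2) * v $ 2 + of_int (n 3) * v $ 3 \<in> theta_ideal"
    using herm_theta_residue[OF v(1) n(2)] v(2) by simp
  moreover have "of_int (n 1) * (v $ 1 - of_int (n 1)) + of_int (n 2) * (v $ 2 - of_int (n 2))
      + of_int (n 3) * (v $ 3 - of_int (n 3)) \<in> theta_ideal"
    using n(2) by (intro theta_ideal_add theta_ideal_mult) auto
  ultimately have "of_int (n 1 * n 1 + n 2 * n 2 + n 3 * n 3) \<in> theta_ideal"
    using theta_ideal_diff by (fastforce simp: algebra_simps)
  then have "7 dvd n 1 * n 1 + n 2 * n 2 + n 3 * n 3"
    unfolding theta_ideal_of_int .
  moreover have "\<not> (n 1 = 0 \<and> n 2 = 0 \<and> n 3 = 0)"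
    using v(3) n(2)[of 1] n(2)[of 2] n(2)[of 3] by (auto simp: forall_3)
  ultimately obtain p q where pq: "(p, q) \<in> isotropic_pairs" "\<not> 7 dvd n 1"
    "7 dvd n 2 - n 1 * p" "7 dvd n 3 - n 1 * q"
    using isotropic_pairs_exhaust[OF n(1) n(1) n(1)] by metis
  have "herm x v \<in> theta_ideal \<longleftrightarrow> x $ 1 + of_int p * x $ 2 + of_int q * x $ 3 \<in> theta_ideal"
    (is "_ \<longleftrightarrow> ?e \<in> _") if x: "x \<in> cube" for x
  proof -
    have "of_int (n 2 - n 1 * p) * x $ 2 + of_int (n 3 - n 1 * q) * x $ 3 \<in> theta_ideal"
      using pq x by (intro theta_ideal_add theta_ideal_of_int_mult cubeD)
    then have "of_int (n 1) * x $ 1 + of_int (n 2) * x $ 2 + of_int (n 3) * x $ 3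
        - of_int (n 1) * ?e \<in> theta_ideal"
      by (simp add: algebra_simps)
    then have "herm x v \<in> theta_ideal \<longleftrightarrow> of_int (n 1) * ?e \<in> theta_ideal"
      unfolding herm_theta_residue[OF x n(2)] by (rule theta_ideal_cong)
    moreover have "?e \<in> Olam_half"
      using x by (intro Olam_half_intros cubeD)
    ultimately show ?thesis
      using theta_ideal_cancel[OF _ pq(2)] theta_ideal_mult[of "of_int (n 1)" ?e] by auto
  qed
  then show ?thesis
    using that[OF pq(1)] by (auto simp: mod_theta_plane_def)
qed

section \<open>The orbit of M[1/2] under the isometries of L[1/2]\<close>

lemma one_notin_theta_ideal: "1 \<notin> theta_ideal"
  using theta_ideal_of_int[of 1] by simp

lemma vec_s_cube: "vec_s \<in> cube"
  by (auto simp: cube_def forall_3 vec_s_def intro!: Olam_half_intros)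

lemma herm_vec_s_self: "herm vec_s vec_s = 7"
  unfolding herm_def vec_s_def
  by (simp add: sum_3 power2_eq_square power3_eq_cube cnj_lam_eq lam_reduce)

lemma vec_s_notin_theta_ideal: "vec_s $ 1 \<notin> theta_ideal"
proof
  assume "vec_s $ 1 \<in> theta_ideal"
  then have "(1 / 2 * cnj lam) * lam \<in> theta_ideal"
    by (intro theta_ideal_mult Olam_half_mult Olam_half_half Olam_half_cnj) (auto simp: vec_s_def)
  then show False
    using one_notin_theta_ideal cnj_lam(2) by (simp add: mult.commute)
qed

lemma matrix_image_theta_ideal:
  assumes "\<And>x. x \<in> cube \<Longrightarrow> A *v x \<in> cube" "\<And>i. v $ i \<in> theta_ideal"
  shows "(A *v v) $ i \<in> theta_ideal"
proof -
  have "\<exists>c\<in>Olam_half. v $ i = theta * c" for i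
    using assms(2)[of i] by (auto simp: theta_ideal_def)
  then obtain c where c: "\<And>i. c i \<in> Olam_half" "\<And>i. v $ i = theta * c i"
    by metis
  then have "v = theta *s (\<chi> i. c i)"
    by (simp add: vec_eq_iff)
  moreover have "A *v (\<chi> i. c i) \<in> cube"
    by (rule assms(1)) (simp add: cube_def c)
  ultimately show ?thesis
    by (auto simp: vector_scalar_commute cubeD)
qed

text \<open>The preimage of the plane orthogonal to \<open>vec_s\<close> is orthogonal to
  \<open>v\<close>, the preimage of \<open>vec_s\<close>. This \<open>v\<close> is isotropic modulo
  \<open>theta\<close> because \<open>herm vec_s vec_s = 7\<close>, and nonzero there because
  \<open>A\<close> would otherwise send it to a vector vanishing modulo
  \<open>theta\<close>.\<close>

lemma Gamma_group_L_preimage: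
  assumes A: "A \<in> Gamma_group lattice_L"
  obtains p q where "(p, q) \<in> isotropic_pairs"
    "{x. A *v x \<in> mod_theta_plane 4 2} = mod_theta_plane p q"
proof -
  have GL: "A \<in> carrier GL3" and uni: "unitary A" and iff: "\<And>x. A *v x \<in> cube \<longleftrightarrow> x \<in> cube"
    using A unfolding Gamma_group_L_iff by blast+
  obtain B where AB: "\<And>x. A *v (B *v x) = x"
    using GL3_inverse[OF GL] by metis
  define v where "v = B *v vec_s"
  have Av: "A *v v = vec_s"
    by (simp add: v_def AB)
  have herm: "herm (A *v x) vec_s = herm x v" for x
    unfolding Av[symmetric] by (rule unitary_herm[OF uni])
  have "v \<in> cube"
    using iff[of v] Av vec_s_cube by simp
  moreover have "herm v v \<in> theta_ideal"
    unfolding herm[symmetric] Av herm_vec_s_self by (rule theta_ideal_seven)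
  moreover have "\<not> (\<forall>i. v $ i \<in> theta_ideal)"
    using matrix_image_theta_ideal[of A v 1] vec_s_notin_theta_ideal iff Av by auto
  ultimately obtain p q where "(p, q) \<in> isotropic_pairs"
    "{x \<in> cube. herm x v \<in> theta_ideal} = mod_theta_plane p q"
    by (rule orthogonal_plane_of_isotropic)
  then show ?thesis
    using that by (simp add: mod_theta_plane_vec_s iff herm)
qed

section \<open>Signed permutation matrices\<close>

definition diag_signs :: "int \<Rightarrow> int \<Rightarrow> complex ^ 3 ^ 3" where
  "diag_signs d e = vector [vector [1, 0, 0], vector [0, of_int d, 0], vector [0, 0, of_int e]]"

definition swap_signs :: "int \<Rightarrow> int \<Rightarrow> complex ^ 3 ^ 3" where
  "swap_signs d e = vector [vector [1, 0, 0], vector [0, 0, of_int d], vector [0, of_int e, 0]]"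

lemma minus_Olam_half_iff: "- x \<in> Olam_half \<longleftrightarrow> x \<in> Olam_half"
  using Olam_half_uminus[of x] Olam_half_uminus[of "- x"] by auto

lemma signs_Gamma_group_L:
  assumes "d \<in> {1, -1}" "e \<in> {1, -1}"
  shows "diag_signs d e \<in> Gamma_group lattice_L" "swap_signs d e \<in> Gamma_group lattice_L"
proof -
  have "unitary (diag_signs d e)" "unitary (swap_signs d e)"
    using assms by (auto simp: unitary_def adjoint_matrix_def matrix_matrix_mult_def mat_def
        vec_eq_iff forall_3 sum_3 diag_signs_def swap_signs_def)
  moreover have "diag_signs d e $ i $ j \<in> Qlam" "swap_signs d e $ i $ j \<in> Qlam" for i j
    using exhaust_3[of i] exhaust_3[of j]
    by (auto simp: diag_signs_def swap_signs_def intro!: Olam_half_Qlam)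
  ultimately show "diag_signs d e \<in> Gamma_group lattice_L" "swap_signs d e \<in> Gamma_group lattice_L"
    using assms unfolding Gamma_group_L_iff
    by (auto simp: unitary_GL3 diag_signs_def swap_signs_def cube_def forall_3
        matrix_vector_mult_def sum_3 minus_Olam_half_iff)
qed

lemma signs_preimage:
  assumes "d \<in> {1, -1}" "e \<in> {1, -1}"
  shows "{x. diag_signs d e *v x \<in> mod_theta_plane 4 2} = mod_theta_plane (4 * d) (2 * e)"
    and "{x. swap_signs d e *v x \<in> mod_theta_plane 4 2} = mod_theta_plane (2 * e) (4 * d)"
proof -
  have "of_int d * y \<in> Olam_half \<longleftrightarrow> y \<in> Olam_half" "of_int e * y \<in> Olam_half \<longleftrightarrow> y \<in> Olam_half" for y
    using assms by (auto simp: minus_Olam_half_iff)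
  then show "{x. diag_signs d e *v x \<in> mod_theta_plane 4 2} = mod_theta_plane (4 * d) (2 * e)"
    and "{x. swap_signs d e *v x \<in> mod_theta_plane 4 2} = mod_theta_plane (2 * e) (4 * d)"
    unfolding mod_theta_plane_def cube_def
    by (simp_all add: diag_signs_def swap_signs_def forall_3 matrix_vector_mult_def sum_3
        mult.assoc add.assoc add.commute add.left_commute conj_commute conj_left_commute)
qed

text \<open>Modulo 7 the eight pairs are \<open>(4 * d, 2 * e)\<close> and
  \<open>(2 * e, 4 * d)\<close> for signs \<open>d\<close> and \<open>e\<close>. The diagonal
  matrices give the first kind, those exchanging the last two coordinates the second.\<close>

lemma isotropic_pairs_realised:
  assumes "(p, q) \<in> isotropic_pairs"
  shows "\<exists>A\<in>Gamma_group lattice_L. {x. A *v x \<in> mod_theta_plane 4 2} = mod_theta_plane p q"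
proof -
  have "\<exists>d\<in>{1, -1}. \<exists>e\<in>{1, -1}. 7 dvd 4 * d - p \<and> 7 dvd 2 * e - q \<or>
      7 dvd 2 * e - p \<and> 7 dvd 4 * d - q"
    using assms by (simp add: isotropic_pairs_def) (elim disjE conjE; simp)
  then obtain d e where de: "d \<in> {1, -1}" "e \<in> {1, -1}"
    "7 dvd 4 * d - p \<and> 7 dvd 2 * e - q \<or> 7 dvd 2 * e - p \<and> 7 dvd 4 * d - q"
    by blast
  from de(3) show ?thesis
  proof
    assume "7 dvd 4 * d - p \<and> 7 dvd 2 * e - q"
    then have "{x. diag_signs d e *v x \<in> mod_theta_plane 4 2} = mod_theta_plane p q"
      using signs_preimage(1)[OF de(1,2)] mod_theta_plane_cong[of "4 * d" p "2 * e" q] by simp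
    then show ?thesis
      using signs_Gamma_group_L[OF de(1,2)] by blast
  next
    assume "7 dvd 2 * e - p \<and> 7 dvd 4 * d - q"
    then have "{x. swap_signs d e *v x \<in> mod_theta_plane 4 2} = mod_theta_plane p q"
      using signs_preimage(2)[OF de(1,2)] mod_theta_plane_cong[of "2 * e" p "4 * d" q] by simp
    then show ?thesis
      using signs_Gamma_group_L[OF de(1,2)] by blast
  qed
qed

lemma card_Gamma_group_L_preimages:
  "card ((\<lambda>A. {x. A *v x \<in> mod_theta_plane 4 2}) ` Gamma_group lattice_L) = 8"
proof -
  have "(\<lambda>A. {x. A *v x \<in> mod_theta_plane 4 2}) ` Gamma_group lattice_L
      = (\<lambda>(p, q). mod_theta_plane p q) ` isotropic_pairs" (is "?L = ?R")
  proof
    show "?L \<subseteq> ?R"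
    proof (rule image_subsetI)
      fix A assume "A \<in> Gamma_group lattice_L"
      then show "{x. A *v x \<in> mod_theta_plane 4 2} \<in> ?R"
        using Gamma_group_L_preimage[of A] by (metis case_prod_conv image_eqI)
    qed
    show "?R \<subseteq> ?L"
    proof clarify
      fix p q assume "(p, q) \<in> isotropic_pairs"
      from isotropic_pairs_realised[OF this] show "mod_theta_plane p q \<in> ?L"
        by blast
    qed
  qed
  moreover have "inj_on (\<lambda>(p, q). mod_theta_plane p q) isotropic_pairs"
  proof (rule inj_onI, clarify)
    fix p q p' q' assume pq: "(p, q) \<in> isotropic_pairs" "(p', q') \<in> isotropic_pairs"
      and "mod_theta_plane p q = mod_theta_plane p' q'"
    then have "7 dvd p' - p \<and> 7 dvd q' - q"
      by (intro mod_theta_plane_inj)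
    then show "p = p' \<and> q = q'"
      using pq by (auto simp: isotropic_pairs_def)
  qed
  ultimately show ?thesis
    by (simp add: card_image isotropic_pairs_def)
qed

section \<open>Lattices between \<open>M[1/2]\<close> and its dual\<close>

text \<open>The dual of M[1/2] in coordinates, as \<open>dual_M_iff\<close> confirms: integral
  vectors plus multiples of \<open>(1, 4, 2) / theta\<close>.\<close>

definition dual_M :: "(complex ^ 3) set" where
  "dual_M = {y. theta * y $ 1 \<in> Olam_half \<and> y $ 2 - 4 * y $ 1 \<in> Olam_half \<and>
     y $ 3 - 2 * y $ 1 \<in> Olam_half}"

text \<open>Together with \<open>e\<^sub>1\<close>, this vector generates the dual of \<open>M[1/2]\<close> modulo \<open>M[1/2]\<close>; the coordinates of
  \<open>x\<close> with respect to these generators are \<open>\<theta> x\<^sub>1\<close> and \<open>x\<^sub>1 + 4 x\<^sub>2 + 2 x\<^sub>3\<close>.\<close>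

definition glue :: "complex ^ 3" where
  "glue = vector [1 / theta, 4 / theta, 2 / theta]"

text \<open>The lattice over the kernel of the linear form with coefficients \<open>(p, r)\<close>
  on the plane \<open>dual_M\<close> modulo M[1/2]; the form \<open>(1, 0)\<close> gives
  \<open>cube\<close>.\<close>

definition overlattice :: "int \<Rightarrow> int \<Rightarrow> (complex ^ 3) set" where
  "overlattice p r = {x \<in> dual_M. of_int p * (theta * x $ 1) +
     of_int r * (x $ 1 + 4 * x $ 2 + 2 * x $ 3) \<in> theta_ideal}"

lemma seven_theta: "7 * x = theta * (- (theta * x))"
  using theta_mult by (simp flip: mult.assoc)

text \<open>On \<open>(1, 4, 2)\<close> the linear form takes the value 21, a multiple of
  \<open>theta * theta\<close>, and this absorbs the denominator \<open>theta\<close> of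
  \<open>x $ 1\<close>.\<close>

lemma dual_M_form:
  assumes "x \<in> dual_M"
  shows "x $ 1 + 4 * x $ 2 + 2 * x $ 3 \<in> Olam_half"
    and "21 * x $ 1 \<in> theta_ideal"
proof -
  have x: "theta * x $ 1 \<in> Olam_half" "x $ 2 - 4 * x $ 1 \<in> Olam_half" "x $ 3 - 2 * x $ 1 \<in> Olam_half"
    using assms by (auto simp: dual_M_def)
  have "21 * x $ 1 = theta * (- 3 * (theta * x $ 1))"
    using seven_theta[of "3 * x $ 1"] by simp
  also have "\<dots> \<in> theta_ideal"
    by (intro theta_idealI Olam_half_mult[OF _ x(1)] Olam_half_uminus) auto
  finally show I: "21 * x $ 1 \<in> theta_ideal" .
  have "21 * x $ 1 + 4 * (x $ 2 - 4 * x $ 1) + 2 * (x $ 3 - 2 * x $ 1) \<in> Olam_half"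
    by (intro Olam_half_add Olam_half_mult[OF _ x(2)] Olam_half_mult[OF _ x(3)] theta_ideal_half[OF I])
      auto
  then show "x $ 1 + 4 * x $ 2 + 2 * x $ 3 \<in> Olam_half"
    by (simp add: algebra_simps)
qed

lemma cube_dual_M: "x \<in> cube \<longleftrightarrow> x \<in> dual_M \<and> theta * x $ 1 \<in> theta_ideal"
proof
  assume "x \<in> cube"
  then have "x $ i \<in> Olam_half" for i
    by (rule cubeD)
  then show "x \<in> dual_M \<and> theta * x $ 1 \<in> theta_ideal"
    unfolding dual_M_def
    by (intro conjI CollectI theta_idealI Olam_half_diff Olam_half_mult) simp_all
next
  assume x: "x \<in> dual_M \<and> theta * x $ 1 \<in> theta_ideal"
  then have 1: "x $ 1 \<in> Olam_half"
    using theta_nonzero by (auto simp: theta_ideal_def)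
  have "x $ 2 - 4 * x $ 1 + 4 * x $ 1 \<in> Olam_half" "x $ 3 - 2 * x $ 1 + 2 * x $ 1 \<in> Olam_half"
    using x unfolding dual_M_def by (intro Olam_half_add Olam_half_mult[OF _ 1]; simp)+
  then show "x \<in> cube"
    using 1 by (simp add: cube_def forall_3)
qed

text \<open>Eliminating \<open>x $ 1\<close> through the congruence that defines the plane turns
  \<open>herm x y\<close> into a combination of the conjugates of the three quantities in
  \<open>dual_M\<close>.\<close>

lemma dual_M_iff: "y \<in> dual_M \<longleftrightarrow> (\<forall>x\<in>mod_theta_plane 4 2. herm x y \<in> Olam_half)"
proof
  assume y: "y \<in> dual_M"
  show "\<forall>x\<in>mod_theta_plane 4 2. herm x y \<in> Olam_half"
  proof
    fix x assume x: "x \<in> mod_theta_plane 4 2"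
    then obtain c where c: "c \<in> Olam_half" "x $ 1 + 4 * x $ 2 + 2 * x $ 3 = theta * c"
      by (auto simp: mod_theta_plane_def theta_ideal_def)
    have x1: "x $ 1 = theta * c - 4 * x $ 2 - 2 * x $ 3"
      using c(2) by (simp add: algebra_simps)
    have "herm x y = 1 / 2 * (- (c * cnj (theta * y $ 1)) + x $ 2 * cnj (y $ 2 - 4 * y $ 1)
        + x $ 3 * cnj (y $ 3 - 2 * y $ 1))"
      by (simp add: herm_def sum_3 x1 cnj_theta algebra_simps)
    also have "\<dots> \<in> Olam_half"
    proof -
      have "cnj (theta * y $ 1) \<in> Olam_half" "cnj (y $ 2 - 4 * y $ 1) \<in> Olam_half"
        "cnj (y $ 3 - 2 * y $ 1) \<in> Olam_half"
        using y unfolding dual_M_def by (blast intro: Olam_half_cnj)+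
      from Olam_half_mult[OF c(1) this(1)] Olam_half_mult[OF cubeD this(2)]
        Olam_half_mult[OF cubeD this(3)]
      show ?thesis
        using mod_theta_plane_cube[OF x]
        by (intro Olam_half_mult[OF Olam_half_half] Olam_half_add Olam_half_uminus)
    qed
    finally show "herm x y \<in> Olam_half" .
  qed
next
  assume y: "\<forall>x\<in>mod_theta_plane 4 2. herm x y \<in> Olam_half"
  \<comment> \<open>These vectors generate M[1/2]; pairing \<open>y\<close> with each of them yields
    one of the conditions of \<open>dual_M\<close>.\<close>
  have m: "vector [theta, 0, 0] \<in> mod_theta_plane 4 2" "vector [- 4, 1, 0] \<in> mod_theta_plane 4 2"
    "vector [- 2, 0, 1] \<in> mod_theta_plane 4 2"
    using theta_idealI[of 1]
    by (auto simp: mod_theta_plane_def cube_def forall_3 intro: Olam_half_uminus)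
  have "cnj (2 * herm x y) \<in> Olam_half" if "x \<in> mod_theta_plane 4 2" for x
    using y that by (intro Olam_half_cnj Olam_half_mult) auto
  from this[OF m(1)] this[OF m(2)] this[OF m(3)] show "y \<in> dual_M"
    by (simp add: dual_M_def herm_def sum_3 cnj_theta minus_Olam_half_iff algebra_simps)
qed

lemma glue_dual_M: "glue \<in> dual_M"
  using theta_nonzero by (simp add: dual_M_def glue_def)

lemma axis_dual_M: "axis 1 1 \<in> dual_M"
  by (auto simp: dual_M_def axis_def intro: Olam_half_uminus)

section \<open>The action of the isometries of M[1/2] on the dual modulo M[1/2]\<close>

lemma Gamma_group_M_dual:
  assumes A: "A \<in> Gamma_group lattice_M"
  shows "A *v y \<in> dual_M \<longleftrightarrow> y \<in> dual_M"
proof -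
  have GL: "A \<in> carrier GL3" and uni: "unitary A"
    and iff: "\<And>x. A *v x \<in> mod_theta_plane 4 2 \<longleftrightarrow> x \<in> mod_theta_plane 4 2"
    using A unfolding Gamma_group_M_iff by blast+
  obtain B where AB: "\<And>x. A *v (B *v x) = x"
    using GL3_inverse[OF GL] by metis
  have "(\<forall>x\<in>mod_theta_plane 4 2. herm x (A *v y) \<in> Olam_half) \<longleftrightarrow>
      (\<forall>x\<in>mod_theta_plane 4 2. herm x y \<in> Olam_half)"
    by (metis AB iff unitary_herm[OF uni])
  then show ?thesis
    by (simp add: dual_M_iff)
qed

text \<open>The remainder \<open>q\<close> is integral, and its linear form equals
  \<open>- (21 * x $ 1)\<close>, which lies in the ideal.\<close>

lemma dual_M_decomposition:
  assumes "x \<in> dual_M"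
  obtains q where "q \<in> mod_theta_plane 4 2"
    "x = (theta * x $ 1) *s glue + (x $ 1 + 4 * x $ 2 + 2 * x $ 3) *s axis 1 1 + q"
proof
  define q :: "complex ^ 3" where
    "q = vector [- (x $ 1 + 4 * x $ 2 + 2 * x $ 3), x $ 2 - 4 * x $ 1, x $ 3 - 2 * x $ 1]"
  show "x = (theta * x $ 1) *s glue + (x $ 1 + 4 * x $ 2 + 2 * x $ 3) *s axis 1 1 + q"
    using theta_nonzero by (simp add: q_def vec_eq_iff forall_3 glue_def axis_def)
  have "q $ 1 + 4 * q $ 2 + 2 * q $ 3 = - (21 * x $ 1)"
    by (simp add: q_def algebra_simps)
  then have "q $ 1 + 4 * q $ 2 + 2 * q $ 3 \<in> theta_ideal"
    using theta_ideal_uminus[OF dual_M_form(2)[OF assms]] by (simp only:)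
  then show "q \<in> mod_theta_plane 4 2"
    using assms dual_M_form(1)[OF assms]
    by (auto simp: mod_theta_plane_def cube_def forall_3 q_def dual_M_def minus_Olam_half_iff
        simp del: minus_add_distrib)
qed

text \<open>Within the dual, \<open>A *v x\<close> lies in \<open>cube\<close> iff its coordinate
  \<open>theta * (A *v x) $ 1\<close> vanishes modulo \<open>theta\<close>. As a function of
  \<open>x\<close> this coordinate is linear and kills M[1/2], so its residues \<open>p\<close> and
  \<open>r\<close> on the two generators determine it.\<close>

lemma Gamma_group_M_preimage:
  assumes A: "A \<in> Gamma_group lattice_M"
    and p: "theta * (A *v glue) $ 1 - of_int p \<in> theta_ideal"
    and r: "theta * (A *v axis 1 1) $ 1 - of_int r \<in> theta_ideal"
  shows "{x. A *v x \<in> cube} = overlattice p r"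
proof -
  have "theta * (A *v x) $ 1 \<in> theta_ideal \<longleftrightarrow> of_int p * (theta * x $ 1) +
     of_int r * (x $ 1 + 4 * x $ 2 + 2 * x $ 3) \<in> theta_ideal" if x: "x \<in> dual_M" for x
  proof (rule theta_ideal_cong)
    obtain q where q: "q \<in> mod_theta_plane 4 2"
      and eq: "x = (theta * x $ 1) *s glue + (x $ 1 + 4 * x $ 2 + 2 * x $ 3) *s axis 1 1 + q"
      using dual_M_decomposition[OF x] .
    have "A *v q \<in> mod_theta_plane 4 2"
      using A q unfolding Gamma_group_M_iff by blast
    then have "theta * (A *v q) $ 1 \<in> theta_ideal"
      by (intro theta_idealI) (auto dest: mod_theta_plane_cube cubeD)
    moreover have "(theta * x $ 1) * (theta * (A *v glue) $ 1 - of_int p) \<in> theta_ideal"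
      using x p by (intro theta_ideal_mult) (auto simp: dual_M_def)
    moreover have "(x $ 1 + 4 * x $ 2 + 2 * x $ 3) * (theta * (A *v axis 1 1) $ 1 - of_int r)
        \<in> theta_ideal"
      using r by (intro theta_ideal_mult dual_M_form(1)[OF x])
    ultimately have "theta * (A *v q) $ 1 + ((theta * x $ 1) * (theta * (A *v glue) $ 1 - of_int p)
        + (x $ 1 + 4 * x $ 2 + 2 * x $ 3) * (theta * (A *v axis 1 1) $ 1 - of_int r)) \<in> theta_ideal"
      by (intro theta_ideal_add)
    moreover have "(A *v x) $ 1 = (theta * x $ 1) * (A *v glue) $ 1 +
        (x $ 1 + 4 * x $ 2 + 2 * x $ 3) * (A *v axis 1 1) $ 1 + (A *v q) $ 1"
      by (subst eq) (simp only: matrix_vector_right_distrib vector_scalar_commute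
          vector_add_component vector_smult_component)
    ultimately show "theta * (A *v x) $ 1 - (of_int p * (theta * x $ 1) +
        of_int r * (x $ 1 + 4 * x $ 2 + 2 * x $ 3)) \<in> theta_ideal"
      by (simp add: algebra_simps)
  qed
  then show ?thesis
    by (auto simp: cube_dual_M Gamma_group_M_dual[OF A] overlattice_def)
qed

text \<open>The vector \<open>x\<close> has coordinates \<open>(r, - p)\<close> modulo
  \<open>theta\<close> and so spans the kernel of the first form. The second form vanishes on it
  only if the determinant of the two forms does.\<close>

lemma overlattice_inj:
  assumes "overlattice p r = overlattice p' r'"
  shows "7 dvd p' * r - r' * p"
proof -
  define x :: "complex ^ 3" where "x = of_int r *s glue - of_int p *s axis 1 1"
  have x: "theta * x $ 1 = of_int r - theta * of_int p"
    "x $ 1 + 4 * x $ 2 + 2 * x $ 3 = of_int r * (21 / theta) - of_int p"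
    using theta_nonzero by (simp_all add: x_def glue_def axis_def field_simps)
  have "21 = theta * (theta * (- 3))"
    using seven_theta[of 3] by simp
  then have "21 / theta = theta * (- 3)"
    using theta_nonzero by (metis nonzero_mult_div_cancel_left)
  then have i: "21 / theta \<in> theta_ideal"
    using theta_idealI[of "- 3"] Olam_half_uminus[of 3] by simp
  have mem: "of_int a * (theta * x $ 1) + of_int b * (x $ 1 + 4 * x $ 2 + 2 * x $ 3) \<in> theta_ideal
      \<longleftrightarrow> 7 dvd a * r - b * p" for a b
  proof -
    have "of_int a * (theta * x $ 1) + of_int b * (x $ 1 + 4 * x $ 2 + 2 * x $ 3)
        - of_int (a * r - b * p) = of_int (b * r) * (21 / theta) - theta * of_int (a * p)"
      unfolding x by (simp add: algebra_simps)
    also have "\<dots> \<in> theta_ideal"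
      by (intro theta_ideal_diff theta_idealI theta_ideal_mult i) auto
    finally show ?thesis
      unfolding theta_ideal_of_int[symmetric] by (rule theta_ideal_cong)
  qed
  have "x $ 2 - 4 * x $ 1 = 4 * of_int p" "x $ 3 - 2 * x $ 1 = 2 * of_int p"
    by (simp_all add: x_def glue_def axis_def algebra_simps)
  then have "x \<in> dual_M"
    unfolding dual_M_def mem_Collect_eq x(1)
    by (auto intro!: Olam_half_diff Olam_half_mult)
  moreover have "7 dvd p * r - r * p"
    by (simp add: mult.commute)
  ultimately have "x \<in> overlattice p r"
    by (simp add: overlattice_def mem)
  then show ?thesis
    unfolding assms by (simp add: overlattice_def mem)
qed

lemma overlattice_cong:
  assumes "\<not> 7 dvd n" "7 dvd p' - n * p" "7 dvd r' - n * r"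
  shows "overlattice p' r' = overlattice p r"
proof -
  have "of_int p' * (theta * x $ 1) + of_int r' * (x $ 1 + 4 * x $ 2 + 2 * x $ 3) \<in> theta_ideal \<longleftrightarrow>
      of_int p * (theta * x $ 1) + of_int r * (x $ 1 + 4 * x $ 2 + 2 * x $ 3) \<in> theta_ideal"
    (is "_ * ?a + _ * ?b \<in> _ \<longleftrightarrow> _") if x: "x \<in> dual_M" for x
  proof -
    have a: "?a \<in> Olam_half" and b: "?b \<in> Olam_half"
      using x dual_M_form(1) by (auto simp: dual_M_def)
    have "of_int (p' - n * p) * ?a + of_int (r' - n * r) * ?b \<in> theta_ideal"
      using assms a b by (intro theta_ideal_add theta_ideal_of_int_mult)
    then have "of_int p' * ?a + of_int r' * ?b - of_int n * (of_int p * ?a + of_int r * ?b)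
        \<in> theta_ideal"
      by (simp add: algebra_simps)
    then have "of_int p' * ?a + of_int r' * ?b \<in> theta_ideal \<longleftrightarrow>
        of_int n * (of_int p * ?a + of_int r * ?b) \<in> theta_ideal"
      by (rule theta_ideal_cong)
    moreover have "of_int p * ?a + of_int r * ?b \<in> Olam_half"
      by (intro Olam_half_add Olam_half_mult[OF _ a] Olam_half_mult[OF _ b]) auto
    ultimately show ?thesis
      using theta_ideal_cancel[OF _ assms(1)]
        theta_ideal_mult[of "of_int n" "of_int p * ?a + of_int r * ?b"] by auto
  qed
  then show ?thesis
    by (auto simp: overlattice_def)
qed

text \<open>Representatives of the 8 points of the projective line over the field with 7
  elements.\<close>

definition projective_line :: "(int \<times> int) set" where
  "projective_line = {(1, 0), (0, 1), (1, 1), (2, 1), (3, 1), (4, 1), (5, 1), (6, 1)}"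

lemma projective_line_exhaust:
  fixes p r :: int
  assumes "p \<in> {0..6}" "r \<in> {0..6}" "\<not> (p = 0 \<and> r = 0)"
  obtains a b n where "(a, b) \<in> projective_line" "\<not> 7 dvd n" "7 dvd p - n * a" "7 dvd r - n * b"
proof -
  have "\<forall>p\<in>set [0..6]. \<forall>r\<in>set [0..6]. \<not> (p = 0 \<and> r = 0) \<longrightarrow>
      (\<exists>x\<in>set [(1, 0), (0, 1), (1, 1), (2, 1), (3, 1), (4, 1), (5, 1), (6, 1 :: int)].
        \<exists>n\<in>set [1..6]. \<not> 7 dvd n \<and> 7 dvd p - n * fst x \<and> 7 dvd r - n * snd x)"
    by code_simp
  from this[unfolded set_upto, rule_format, OF assms] obtain x n where
    "x \<in> projective_line" "\<not> 7 dvd n" "7 dvd p - n * fst x" "7 dvd r - n * snd x"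
    unfolding projective_line_def list.set by blast
  then show ?thesis
    by (intro that[of "fst x" "snd x" n]) simp_all
qed

lemma Gamma_group_M_preimage_exhaust:
  assumes A: "A \<in> Gamma_group lattice_M"
  obtains p r where "(p, r) \<in> projective_line" "{x. A *v x \<in> cube} = overlattice p r"
proof -
  have "theta * y $ 1 \<in> Olam_half" if "y \<in> dual_M" for y
    using that by (simp add: dual_M_def)
  then have coords: "theta * (A *v glue) $ 1 \<in> Olam_half" "theta * (A *v axis 1 1) $ 1 \<in> Olam_half"
    by (simp_all add: Gamma_group_M_dual[OF A] glue_dual_M axis_dual_M)
  obtain p where p: "p \<in> {0..6}" "theta * (A *v glue) $ 1 - of_int p \<in> theta_ideal"
    using theta_residue[OF coords(1)] .
  obtain r where r: "r \<in> {0..6}" "theta * (A *v axis 1 1) $ 1 - of_int r \<in> theta_ideal"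
    using theta_residue[OF coords(2)] .
  have eq: "{x. A *v x \<in> cube} = overlattice p r"
    by (rule Gamma_group_M_preimage[OF A p(2) r(2)])
  have "\<not> (p = 0 \<and> r = 0)"
  proof
    assume "p = 0 \<and> r = 0"
    \<comment> \<open>Then \<open>A\<close> would carry the whole dual into \<open>cube\<close>; but
      it maps the dual onto itself, and \<open>glue\<close> is not integral.\<close>
    then have all: "A *v x \<in> cube" if "x \<in> dual_M" for x
      using eq that by (auto simp: overlattice_def)
    have "A \<in> carrier GL3"
      using A unfolding Gamma_group_M_iff by blast
    then obtain B where AB: "\<And>x. A *v (B *v x) = x"
      using GL3_inverse by metis
    have "B *v glue \<in> dual_M"
      using Gamma_group_M_dual[OF A, of "B *v glue"] glue_dual_M by (simp add: AB)
    from all[OF this] have "theta * glue $ 1 \<in> theta_ideal"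
      by (simp add: AB cube_dual_M)
    then show False
      using one_notin_theta_ideal theta_nonzero by (simp add: glue_def)
  qed
  from projective_line_exhaust[OF p(1) r(1) this] obtain a b n where
    ab: "(a, b) \<in> projective_line" "\<not> 7 dvd n" "7 dvd p - n * a" "7 dvd r - n * b" .
  show ?thesis
    using that[OF ab(1)] eq overlattice_cong[OF ab(2-4)] by simp
qed

section \<open>Explicit isometries of M[1/2] reaching every line\<close>

text \<open>This is \<open>cnj \<lambda> / \<lambda>\<close>.\<close>

definition unit_w :: complex where
  "unit_w = (lam - 1) / 2"

lemma unit_w_half: "unit_w \<in> Olam_half"
proof -
  have "1 / 2 * (lam - 1) \<in> Olam_half"
    by (intro Olam_half_intros)
  then show ?thesis
    by (simp add: unit_w_def)
qed

lemma unit_w_cnj: "unit_w * cnj unit_w = 1"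
  by (simp add: unit_w_def cnj_lam_eq lam_reduce)

text \<open>Modulo \<open>theta ^ 2\<close> one has \<open>unit_w = 1 + 2 * theta\<close>, so its
  \<open>k\<close>-th power is \<open>1 + 2 * k * theta\<close>.\<close>

lemma unit_w_power:
  "\<exists>c\<in>Olam_half. unit_w ^ k - 1 = theta * c \<and> c - of_int (2 * int k) \<in> theta_ideal"
proof (induction k)
  case 0
  show ?case
    by (intro bexI[of _ 0]) auto
next
  case (Suc k)
  then obtain c where c: "c \<in> Olam_half" "unit_w ^ k - 1 = theta * c"
    "c - of_int (2 * int k) \<in> theta_ideal"
    by blast
  define c1 where "c1 = 1 / 2 * (1 + lam)"
  have c1: "c1 \<in> Olam_half"
    unfolding c1_def by (intro Olam_half_intros)
  have w1: "unit_w - 1 = theta * c1"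
    by (simp add: unit_w_def theta_eq c1_def lam_reduce) (simp add: field_simps)
  have "c1 - 2 = 1 / 2 * (lam - 3)"
    by (simp add: c1_def)
  then have c12: "c1 - 2 \<in> theta_ideal"
    using theta_ideal_mult[OF Olam_half_half theta_ideal_lam] by (simp only:)
  have "unit_w ^ Suc k - 1 = unit_w * (unit_w ^ k - 1) + (unit_w - 1)"
    by (simp add: algebra_simps)
  also have "\<dots> = theta * (unit_w * c + c1)"
    unfolding c(2) w1 by (simp add: algebra_simps)
  finally have "unit_w ^ Suc k - 1 = theta * (unit_w * c + c1)" .
  moreover have "c * (unit_w - 1) + ((c - of_int (2 * int k)) + (c1 - 2)) \<in> theta_ideal"
    unfolding w1 using c c12 c1 by (intro theta_ideal_add theta_ideal_mult theta_idealI)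
  then have "unit_w * c + c1 - of_int (2 * int (Suc k)) \<in> theta_ideal"
    by (simp add: algebra_simps)
  moreover have "unit_w * c + c1 \<in> Olam_half"
    using unit_w_half c c1 by auto
  ultimately show ?case
    by blast
qed

text \<open>On the dual modulo M[1/2] this diagonal matrix is unipotent: it fixes
  \<open>axis 1 1\<close> and adds \<open>k\<close> times that vector to \<open>glue\<close>, since
  the last entry of \<open>glue\<close> changes by \<open>2 * c\<close> with \<open>c\<close>
  congruent to \<open>2 * k\<close>, and \<open>2 * 2 * 2 * k\<close> is \<open>k\<close> modulo
  7.\<close>

definition shear :: "nat \<Rightarrow> complex ^ 3 ^ 3" where
  "shear k = vector [vector [1, 0, 0], vector [0, 1, 0], vector [0, 0, unit_w ^ k]]"

text \<open>The entry \<open>unit_w ^ k\<close> has absolute value 1 and is congruent to 1 modulo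
  \<open>theta\<close>, so it leaves the defining linear form unchanged there.\<close>

lemma shear_Gamma_group_M: "shear k \<in> Gamma_group lattice_M"
proof -
  obtain c where c: "c \<in> Olam_half" "unit_w ^ k - 1 = theta * c"
    using unit_w_power by blast
  define u where "u = unit_w ^ k"
  have S: "shear k = vector [vector [1, 0, 0], vector [0, 1, 0], vector [0, 0, u]]"
    by (simp add: shear_def u_def)
  have u: "cnj u * u = 1"
    by (simp add: u_def unit_w_cnj mult.commute flip: power_mult_distrib)
  have uR: "u \<in> Olam_half" "cnj u \<in> Olam_half"
    unfolding u_def by (intro Olam_half_cnj Olam_half_power unit_w_half)+
  have "unitary (shear k)"
    by (simp add: unitary_def adjoint_matrix_def matrix_matrix_mult_def mat_def
        vec_eq_iff forall_3 sum_3 S u)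
  moreover have "shear k $ i $ j \<in> Qlam" for i j
    using exhaust_3[of i] exhaust_3[of j] uR(1)
    by (auto simp: S intro!: Olam_half_Qlam)
  moreover have "shear k *v x \<in> mod_theta_plane 4 2 \<longleftrightarrow> x \<in> mod_theta_plane 4 2" for x
  proof -
    have "cnj u * (u * x $ 3) = x $ 3"
      using u by (simp flip: mult.assoc)
    then have 1: "u * x $ 3 \<in> Olam_half \<longleftrightarrow> x $ 3 \<in> Olam_half"
      using uR by (metis Olam_half_mult)
    have 2: "x $ 1 + 4 * x $ 2 + 2 * (u * x $ 3) \<in> theta_ideal \<longleftrightarrow>
        x $ 1 + 4 * x $ 2 + 2 * x $ 3 \<in> theta_ideal" if "x $ 3 \<in> Olam_half"
    proof (rule theta_ideal_cong)
      have "(2 * x $ 3) * (theta * c) \<in> theta_ideal"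
        using that c by (intro theta_ideal_mult theta_idealI Olam_half_mult) auto
      then have "(2 * x $ 3) * (u - 1) \<in> theta_ideal"
        by (simp only: c(2) u_def)
      then show "x $ 1 + 4 * x $ 2 + 2 * (u * x $ 3) - (x $ 1 + 4 * x $ 2 + 2 * x $ 3)
          \<in> theta_ideal"
        by (simp add: algebra_simps)
    qed
    have "(shear k *v x) $ 1 = x $ 1" "(shear k *v x) $ 2 = x $ 2" "(shear k *v x) $ 3 = u * x $ 3"
      by (simp_all add: S matrix_vector_mult_def sum_3)
    then show ?thesis
      using 1 2 by (auto simp: mod_theta_plane_def cube_def forall_3)
  qed
  ultimately show ?thesis
    unfolding Gamma_group_M_iff by (simp add: unitary_GL3)
qed

text \<open>The columns are \<open>z / \<theta>\<close> for pairwise orthogonal \<open>z\<close> with entries of norms 1, 2, 4 and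
  \<open>z \<equiv> c (1, 4, 2)\<close> modulo \<open>\<theta>\<close>; this makes the matrix unitary and maps \<open>L[1/2]\<close> into the dual of \<open>M[1/2]\<close>.\<close>

definition mover :: "complex ^ 3 ^ 3" where
  "mover = vector [vector [1 / theta, - cnj lam / theta, lam ^ 2 / theta],
     vector [- cnj lam / theta, 2 / theta, 1 / theta],
     vector [lam ^ 2 / theta, 1 / theta, - lam / theta]]"

lemma Qlam_div_theta: "x \<in> Olam_half \<Longrightarrow> x / theta \<in> Qlam"
proof -
  assume x: "x \<in> Olam_half"
  have "x / theta = of_rat (- 1 / 7) * (theta * x)"
    using seven_theta[of x] theta_nonzero by (simp add: of_rat_divide of_rat_minus field_simps)
  also have "\<dots> \<in> Qlam"
    using x by (intro Qlam_mult Qlam_of_rat Olam_half_Qlam) auto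
  finally show ?thesis .
qed

lemma mover_mult:
  "mover *v x = vector [(x $ 1 - cnj lam * x $ 2 + lam ^ 2 * x $ 3) / theta,
     (- cnj lam * x $ 1 + 2 * x $ 2 + x $ 3) / theta, (lam ^ 2 * x $ 1 + x $ 2 - lam * x $ 3) / theta]"
  by (simp add: mover_def matrix_vector_mult_def vec_eq_iff forall_3 sum_3 add_divide_distrib
      diff_divide_distrib)

lemma cnj_div_theta: "cnj (x / theta) * (y / theta) = (cnj x * y) / 7"
  using theta_mult by (simp add: cnj_theta)

lemma unitary_mover: "unitary mover"
proof -
  have "(\<Sum>k\<in>UNIV. cnj (mover $ k $ i) * mover $ k $ j) = mat 1 $ i $ j" for i j
    using exhaust_3[of i] exhaust_3[of j] unfolding mover_def sum_3
    by (elim disjE; simp only: vector_3 cnj_div_theta add_divide_distrib[symmetric] mat_def)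
      (simp_all add: cnj_lam_eq power2_eq_square lam_reduce)
  then show ?thesis
    by (simp add: unitary_def adjoint_matrix_def matrix_matrix_mult_def vec_eq_iff)
qed

lemma div_theta_half: "x \<in> theta_ideal \<Longrightarrow> x / theta \<in> Olam_half"
  using theta_nonzero by (auto simp: theta_ideal_def)

text \<open>Before division by \<open>theta\<close> the rows of \<open>mover\<close> are congruent
  to 1, 4 and 2 times \<open>(1, 4, 2)\<close>, which makes the image integral. The three displayed
  combinations are the rows, rewritten through the linear form, \<open>lam - 3\<close> and
  7.\<close>

lemma mover_mod_theta_plane:
  assumes "x \<in> mod_theta_plane 4 2"
  shows "mover *v x \<in> mod_theta_plane 4 2"
proof -
  let ?t = "x $ 1 + 4 * x $ 2 + 2 * x $ 3"
  have x: "x $ i \<in> Olam_half" for i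
    using assms by (auto dest: mod_theta_plane_cube cubeD)
  have t: "?t \<in> theta_ideal"
    using assms by (simp add: mod_theta_plane_def)
  have l: "(lam - 3) * y \<in> theta_ideal" if "y \<in> Olam_half" for y
    using theta_ideal_mult[OF that theta_ideal_lam] by (simp add: mult.commute)
  have s: "7 * y \<in> theta_ideal" if "y \<in> Olam_half" for y
    using theta_ideal_mult[OF that theta_ideal_seven] by (simp add: mult.commute)
  have "?t + (lam - 3) * (x $ 2 - x $ 3) - 7 * x $ 3 \<in> theta_ideal"
    by (intro theta_ideal_add theta_ideal_diff t l s x Olam_half_diff)
  then have 1: "x $ 1 - cnj lam * x $ 2 + lam ^ 2 * x $ 3 \<in> theta_ideal"
    by (simp add: cnj_lam_eq power2_eq_square lam_reduce)
  have "4 * ?t + (lam - 3) * x $ 1 - 7 * (2 * x $ 2 + x $ 3) \<in> theta_ideal"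
    using x by (intro theta_ideal_add theta_ideal_diff theta_ideal_mult[OF _ t] l s Olam_half_add
        Olam_half_mult) auto
  then have 2: "- cnj lam * x $ 1 + 2 * x $ 2 + x $ 3 \<in> theta_ideal"
    by (simp add: cnj_lam_eq lam_reduce)
  have "2 * ?t - (lam - 3) * (x $ 1 + x $ 3) - 7 * (x $ 1 + x $ 2 + x $ 3) \<in> theta_ideal"
    using x by (intro theta_ideal_add theta_ideal_diff theta_ideal_mult[OF _ t] l s Olam_half_add
        Olam_half_mult) auto
  then have 3: "lam ^ 2 * x $ 1 + x $ 2 - lam * x $ 3 \<in> theta_ideal"
    by (simp add: power2_eq_square lam_reduce)
  \<comment> \<open>For the linear form of the image, divisibility by \<open>theta\<close> is needed
    once more after the division: the weighted sum of the numerators is \<open>theta\<close> times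
    this expression, which is congruent to \<open>?t\<close>.\<close>
  have "?t - (lam - 3) * (3 * x $ 2 + x $ 3) - 7 * (2 * x $ 2 + x $ 3) \<in> theta_ideal"
    using x by (intro theta_ideal_diff t l s Olam_half_add Olam_half_mult) auto
  also have "?t - (lam - 3) * (3 * x $ 2 + x $ 3) - 7 * (2 * x $ 2 + x $ 3) =
      (theta * x $ 1 + theta * (- 1 - 3 * lam) * x $ 2 + theta * (- 2 - lam) * x $ 3) / theta"
    using theta_nonzero by (simp add: field_simps)
  also have "theta * x $ 1 + theta * (- 1 - 3 * lam) * x $ 2 + theta * (- 2 - lam) * x $ 3 =
      (x $ 1 - cnj lam * x $ 2 + lam ^ 2 * x $ 3) + 4 * (- cnj lam * x $ 1 + 2 * x $ 2 + x $ 3)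
      + 2 * (lam ^ 2 * x $ 1 + x $ 2 - lam * x $ 3)"
    by (simp add: cnj_lam_eq power2_eq_square theta_eq lam_reduce)
  finally have X: "\<dots> / theta \<in> theta_ideal" .
  have "a / theta + 4 * (b / theta) + 2 * (c / theta) = (a + 4 * b + 2 * c) / theta" for a b c
    by (simp add: add_divide_distrib)
  with X have "(mover *v x) $ 1 + of_int 4 * (mover *v x) $ 2 + of_int 2 * (mover *v x) $ 3
      \<in> theta_ideal"
    by (simp only: mover_mult vector_3 of_int_numeral)
  moreover have "mover *v x \<in> cube"
    using div_theta_half[OF 1] div_theta_half[OF 2] div_theta_half[OF 3]
    by (simp add: mover_mult cube_def forall_3)
  ultimately show ?thesis
    unfolding mod_theta_plane_def by blast
qed

lemma cnj_mod_theta_plane: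
  assumes "x \<in> mod_theta_plane b c"
  shows "(\<chi> i. cnj (x $ i)) \<in> mod_theta_plane b c"
proof -
  have "cnj (x $ 1 + of_int b * x $ 2 + of_int c * x $ 3) \<in> theta_ideal"
    using assms by (intro theta_ideal_cnj) (simp add: mod_theta_plane_def)
  moreover have "cnj (x $ i) \<in> Olam_half" for i
    by (intro Olam_half_cnj cubeD mod_theta_plane_cube[OF assms])
  ultimately show ?thesis
    by (simp add: mod_theta_plane_def cube_def)
qed

lemma mover_Gamma_group_M: "mover \<in> Gamma_group lattice_M"
proof -
  have "lam ^ 2 \<in> Olam_half" "cnj lam \<in> Olam_half" "- cnj lam \<in> Olam_half" "- lam \<in> Olam_half"
    by (intro Olam_half_intros)+
  then have "mover $ i $ j \<in> Qlam" for i j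
    using exhaust_3[of i] exhaust_3[of j] unfolding mover_def
    by (elim disjE; simp only: vector_3) (simp_all add: Qlam_div_theta del: divide_minus_left)
  then have "mover \<in> carrier GL3"
    by (rule unitary_GL3[OF unitary_mover])
  moreover have "x \<in> mod_theta_plane 4 2" if "mover *v x \<in> mod_theta_plane 4 2" for x
  proof -
    \<comment> \<open>The matrix \<open>mover\<close> is symmetric, so its inverse is its entrywise
      conjugate, and conjugation preserves the plane.\<close>
    have adj: "adjoint_matrix mover *v y = (\<chi> i. cnj ((mover *v (\<chi> i. cnj (y $ i))) $ i))" for y
      by (simp add: vec_eq_iff forall_3 adjoint_matrix_def matrix_vector_mult_def sum_3 mover_def)
    have "adjoint_matrix mover *v (mover *v x) \<in> mod_theta_plane 4 2"
      unfolding adj by (intro cnj_mod_theta_plane mover_mod_theta_plane that)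
    moreover have "adjoint_matrix mover *v (mover *v x) = x"
      using unitary_mover by (simp add: matrix_vector_mul_assoc unitary_def)
    ultimately show ?thesis
      by simp
  qed
  ultimately show ?thesis
    unfolding Gamma_group_M_iff using mover_mod_theta_plane unitary_mover by blast
qed

lemma Gamma_group_mult:
  assumes "A \<in> Gamma_group N" "B \<in> Gamma_group N"
  shows "A ** B \<in> Gamma_group N"
  using subgroup.m_closed[OF subgroup_Gamma_group assms] by (simp add: GL3_mult)

text \<open>The generator \<open>axis 1 1\<close> contributes exactly 1. For \<open>glue\<close>,
  writing \<open>unit_w ^ k = 1 + theta * c\<close> makes the value
  \<open>1 + 2 * lam ^ 2 * c\<close>.\<close>

lemma mover_shear_preimage:
  "{x. (mover ** shear k) *v x \<in> cube} = overlattice (1 + int k) 1"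
proof (rule Gamma_group_M_preimage)
  show "mover ** shear k \<in> Gamma_group lattice_M"
    by (intro Gamma_group_mult mover_Gamma_group_M shear_Gamma_group_M)
  show "theta * ((mover ** shear k) *v axis 1 1) $ 1 - of_int 1 \<in> theta_ideal"
    using theta_nonzero unfolding matrix_vector_mul_assoc[symmetric] mover_mult
    by (simp add: shear_def axis_def matrix_vector_mult_def sum_3)
next
  obtain c where c: "c \<in> Olam_half" "unit_w ^ k - 1 = theta * c"
    "c - of_int (2 * int k) \<in> theta_ideal"
    using unit_w_power by blast
  have w: "unit_w ^ k = 1 + theta * c"
    using c(2) by (simp add: algebra_simps)
  have "theta * ((mover ** shear k) *v glue) $ 1 = (1 - 4 * cnj lam + 2 * lam ^ 2 * unit_w ^ k) / theta"
    using theta_nonzero unfolding matrix_vector_mul_assoc[symmetric] mover_mult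
    by (simp add: shear_def glue_def matrix_vector_mult_def sum_3 field_simps)
  also have "1 - 4 * cnj lam + 2 * lam ^ 2 * unit_w ^ k = theta * (1 + 2 * lam ^ 2 * c)"
    unfolding w by (simp add: cnj_lam_eq power2_eq_square theta_eq lam_reduce)
  also have "\<dots> / theta = 1 + 2 * lam ^ 2 * c"
    using theta_nonzero by simp
  \<comment> \<open>With \<open>lam\<close> of residue 3 and \<open>c\<close> of residue
    \<open>2 * k\<close>, the product \<open>2 * lam ^ 2 * c\<close> has residue
    \<open>36 * k\<close>, that is, \<open>k\<close>.\<close>
  finally have "theta * ((mover ** shear k) *v glue) $ 1 - of_int (1 + int k) =
      2 * lam ^ 2 * (c - of_int (2 * int k)) - of_int (4 * int k) * (lam - 3) - of_int (3 * int k) * 7"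
    by (simp add: power2_eq_square lam_reduce)
  also have "\<dots> \<in> theta_ideal"
    by (intro theta_ideal_diff[OF theta_ideal_diff[OF theta_ideal_mult[OF _ c(3)]
          theta_ideal_mult[OF _ theta_ideal_lam]] theta_ideal_mult[OF _ theta_ideal_seven]]
        Olam_half_intros)
  finally show "theta * ((mover ** shear k) *v glue) $ 1 - of_int (1 + int k) \<in> theta_ideal" .
qed

lemma projective_line_realised:
  assumes "(p, r) \<in> projective_line"
  shows "\<exists>A\<in>Gamma_group lattice_M. {x. A *v x \<in> cube} = overlattice p r"
proof (cases "r = 0")
  case True
  then have "p = 1"
    using assms by (auto simp: projective_line_def)
  moreover have "mat 1 \<in> Gamma_group lattice_M"
    using subgroup.one_closed[OF subgroup_Gamma_group] by (simp add: GL3_one)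
  moreover have "{x. mat 1 *v x \<in> cube} = overlattice 1 0"
    by (auto simp: overlattice_def cube_dual_M)
  ultimately show ?thesis
    using True by blast
next
  case False
  then have r: "r = 1" and p: "p \<ge> 0"
    using assms by (auto simp: projective_line_def)
  \<comment> \<open>The exponent \<open>p + 6\<close> stands for \<open>p - 1\<close> modulo 7 and
    stays a natural number when \<open>p = 0\<close>.\<close>
  have "overlattice (1 + int (nat (p + 6))) 1 = overlattice p r"
    using p by (intro overlattice_cong[of 1]) (simp_all add: r)
  then show ?thesis
    using mover_shear_preimage[of "nat (p + 6)"]
    by (intro bexI[of _ "mover ** shear (nat (p + 6))"] Gamma_group_mult mover_Gamma_group_M
        shear_Gamma_group_M) simp
qed

section \<open>The orbit of L[1/2] and the two indices\<close>

lemma card_Gamma_group_M_preimages: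
  "card ((\<lambda>A. {x. A *v x \<in> cube}) ` Gamma_group lattice_M) = 8"
proof -
  have "(\<lambda>A. {x. A *v x \<in> cube}) ` Gamma_group lattice_M
      = (\<lambda>(p, r). overlattice p r) ` projective_line" (is "?L = ?R")
  proof
    show "?L \<subseteq> ?R"
    proof (rule image_subsetI)
      fix A assume "A \<in> Gamma_group lattice_M"
      then show "{x. A *v x \<in> cube} \<in> ?R"
        using Gamma_group_M_preimage_exhaust[of A] by (metis case_prod_conv image_eqI)
    qed
    show "?R \<subseteq> ?L"
    proof clarify
      fix p r assume "(p, r) \<in> projective_line"
      from projective_line_realised[OF this] show "overlattice p r \<in> ?L"
        by blast
    qed
  qed
  moreover have "inj_on (\<lambda>(p, r). overlattice p r) projective_line"
  proof (rule inj_onI)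
    fix x y assume "x \<in> projective_line" "y \<in> projective_line"
      and "(\<lambda>(p, r). overlattice p r) x = (\<lambda>(p, r). overlattice p r) y"
    moreover from this have "7 dvd fst y * snd x - snd y * fst x"
      by (intro overlattice_inj) (simp add: case_prod_unfold)
    moreover have "\<forall>x\<in>set [(1, 0), (0, 1), (1, 1), (2, 1), (3, 1), (4, 1), (5, 1), (6, 1 :: int)].
        \<forall>y\<in>set [(1, 0), (0, 1), (1, 1), (2, 1), (3, 1), (4, 1), (5, 1), (6, 1 :: int)].
          (7 :: int) dvd fst y * snd x - snd y * fst x \<longrightarrow> x = y"
      by code_simp
    ultimately show "x = y"
      unfolding projective_line_def list.set by blast
  qed
  ultimately show ?thesis
    by (simp add: card_image projective_line_def)
qed

theorem theorem3p3:
  "card (rcosets\<^bsub>GL3\<lparr>carrier := Gamma_group lattice_L\<rparr>\<^esub> (Gamma_group lattice_L \<inter> Gamma_group lattice_M)) = 8 \<and>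
   card (rcosets\<^bsub>GL3\<lparr>carrier := Gamma_group lattice_M\<rparr>\<^esub> (Gamma_group lattice_L \<inter> Gamma_group lattice_M)) = 8"
proof
  show "card (rcosets\<^bsub>GL3\<lparr>carrier := Gamma_group lattice_L\<rparr>\<^esub> (Gamma_group lattice_L \<inter> Gamma_group lattice_M)) = 8"
    using card_rcosets_Gamma_group[OF theta_lattice_L theta_lattice_M] card_Gamma_group_L_preimages
    by (simp add: localize_lattice_M)
  have "Gamma_group lattice_L \<inter> Gamma_group lattice_M = Gamma_group lattice_M \<inter> Gamma_group lattice_L"
    by blast
  then show "card (rcosets\<^bsub>GL3\<lparr>carrier := Gamma_group lattice_M\<rparr>\<^esub> (Gamma_group lattice_L \<inter> Gamma_group lattice_M)) = 8"
    using card_rcosets_Gamma_group[OF theta_lattice_M theta_lattice_L] card_Gamma_group_M_preimages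
    by (simp add: localize_lattice_L)
qed

end
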